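(* For $q<c\le1$ let $\{P_n^{(c)}\}_{n=0}^\infty$ be the class of monic polynomials ($\deg P_n^{(c)}=n$) with orthogonality condition \[ \int_{-\infty}^{\infty}P_n^{(c)}(cx)P_m^{(c)}(cx)w(cx)\,d_qx=\gamma_n^{(c)}\delta_{n,m}. \] Then the two classes of orthogonal polynomials corresponding to $c=1$ and $c=q^{1/2}$ are the same. Furthermore, \[ \frac{\gamma_1^{(1)}}{\gamma_1^{(q^{1/2})}}=\frac{q^{1/2}\,h_q(e^{i\pi/4})}{h_q(q^{1/2}e^{i\pi/4})}. \] Moreover, if $c\neq1,\,q^{1/2}$, then $\{P_n^{(c)}\}_{n=0}^\infty\neq\{P_n^{(1)}\}_{n=0}^\infty$.
   Context: $q\in\mathbb{R}$, $0<q<1$; $(x;q)_\infty=\prod_{j\ge0}(1-xq^j)$; $w(x)=1/(-x^4;q^4)_\infty$; $\int_{-\infty}^{\infty}f(x)\,d_qx=\sum_{k\in\mathbb{Z}}q^k\big(f(q^k)+f(-q^k)\big)$; $h_q(z)=\sum_{k\in\mathbb{Z}}\frac{2zq^k}{z^2-q^{2k}}$ for $z\in\mathbb{C}\setminus(\{0\}\cup\{\pm q^k\}_{k\in\mathbb{Z}})$. *)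

theory Defs
  imports "HOL-Analysis.Analysis" "HOL-Computational_Algebra.Polynomial"
begin

text \<open>The infinite \<open>q\<close>-shifted factorial \<open>(x;q)\<^sub>\<infinity>\<close>, meant for \<open>\<bar>q\<bar> < 1\<close>.\<close>

definition qpoch_inf :: "real \<Rightarrow> real \<Rightarrow> real" where
  "qpoch_inf x q = (\<Prod>j. 1 - x * q ^ j)"

definition weight :: "real \<Rightarrow> real \<Rightarrow> real" where
  "weight q x = 1 / qpoch_inf (- (x ^ 4)) (q ^ 4)"

text \<open>The bilateral \<open>q\<close>-integral over the real line, as a relation so that convergence
  (unconditional, i.e. absolute) of the two-sided series is part of the meaning.
  It is normalised without the factor \<open>1 - q\<close> of the usual Jackson integral.\<close>

definition has_dq_integral :: "real \<Rightarrow> (real \<Rightarrow> real) \<Rightarrow> real \<Rightarrow> bool" where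
  "has_dq_integral q f I \<longleftrightarrow>
     ((\<lambda>k::int. q powi k * (f (q powi k) + f (- (q powi k)))) has_sum I) UNIV"

text \<open>\<open>z\<close> is meant to avoid \<open>0\<close> and all \<open>\<plusminus>q\<^sup>k\<close>; there the series converges absolutely.\<close>

definition hq :: "real \<Rightarrow> complex \<Rightarrow> complex" where
  "hq q z = (\<Sum>\<^sub>\<infinity>k::int. 2 * z * of_real (q powi k) / (z\<^sup>2 - of_real (q powi (2 * k))))"

definition monic_orthogonal ::
  "real \<Rightarrow> real \<Rightarrow> (nat \<Rightarrow> real poly) \<Rightarrow> (nat \<Rightarrow> real) \<Rightarrow> bool" where
  "monic_orthogonal q c P \<gamma> \<longleftrightarrow>
     (\<forall>n. degree (P n) = n \<and> lead_coeff (P n) = 1) \<and>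
     (\<forall>n m. has_dq_integral q
        (\<lambda>x. poly (P n) (c * x) * poly (P m) (c * x) * weight q (c * x))
        (if n = m then \<gamma> n else 0))"

end

theory Submission
  imports Defs
begin

text \<open>
  The \<open>q\<close>-integral of \<open>f(cx)\<close> runs over the nodes \<open>\<plusminus>x\<close> with \<open>x = c q\<^sup>k\<close>. It is a positive definite functional with
  vanishing odd moments, and the even ones are, up to the factor \<open>2/c\<close>, the bilateral sums \<open>\<Sum> x\<^sup>n w(x)\<close> with odd \<open>n\<close>.
  Ramanujan's summation, in the degenerate form of \<open>bilateral_sum\<close>, evaluates them: for a constant \<open>K\<^sub>n\<close> that does
  not depend on \<open>c\<close>, and a denominator \<open>D(c)\<close> that does not depend on \<open>n\<close>, the sum is
  \<open>K\<^sub>n c\<^sup>n \<theta>(c\<^sup>4 q\<^sup>n) / D(c)\<close>, where \<open>\<theta>(x) = \<Sum>\<^sub>l Q\<^bsup>l(l-1)/2\<^esup> x\<^sup>l\<close> and \<open>Q = q\<^sup>4\<close>.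

  Monic orthogonal polynomials depend only on the ratios of the moments. A reflection of the summation index in
  \<open>\<theta>\<close> shows that all the moments for \<open>c = q\<^bsup>1/2\<^esup>\<close> are the same multiple of those for \<open>c = 1\<close> (\<open>dq_moment_sqrt\<close>),
  so the polynomials agree (\<open>orthogonal_family_unique\<close>). Conversely, the constant coefficient of the polynomial of
  degree 2 is minus the ratio of the moments of degree 2 and 0. If that ratio is the same for \<open>c\<close> and for \<open>1\<close>, then
  \<open>\<theta>(c\<^sup>4 q) - c\<^sup>2 \<theta>(c\<^sup>4 q\<^sup>3) = 0\<close>. The left-hand side is the sum of the even and the odd terms of
  \<open>\<Sum>\<^sub>m (-1)\<^sup>m q\<^bsup>m(m-1)/2\<^esup> c\<^bsup>2m\<^esup>\<close>, which by Jacobi's triple product vanishes only if \<open>c\<^sup>2\<close> is an integral power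
  of \<open>q\<close> (\<open>theta_nonzero\<close>). In the given range this leaves \<open>c = 1\<close> and
  \<open>c = q\<^bsup>1/2\<^esup>\<close> (\<open>moment_ratio_distinct\<close>).

  The polynomial of degree 1 is \<open>x\<close>, so the quotient of its norms is the quotient of the moments of degree 2, and by
  proportionality also of those of degree 0. The latter involve \<open>\<Sum> x w(x)\<close>. The weight is an infinite product of the
  functions \<open>1 / (1 + x\<^sup>4 Q\<^sup>j)\<close>; introducing its factors one at a time changes the bilateral sum only by factors
  independent of \<open>c\<close>, hence \<open>\<Sum> x w(x)\<close> is a fixed multiple of \<open>\<Sum> x / (1 + x\<^sup>4)\<close>
  (\<open>jackson_first_moment_proportional\<close>). For \<open>c = 1\<close> and \<open>c = q\<^bsup>1/2\<^esup>\<close> the nodes are closed under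
  \<open>x \<mapsto> 1/x\<close>, and this sum is then, up to a common factor, the value of \<open>h\<^sub>q\<close> at \<open>c e\<^bsup>i\<pi>/4\<^esup>\<close> (\<open>hq_diagonal\<close>).
\<close>

section \<open>Infinite shifted factorials\<close>

lemma convergent_prod_qpoch:
  fixes x p :: real
  assumes "0 < p" "p < 1"
  shows "convergent_prod (\<lambda>j. 1 - x * p ^ j)"
proof -
  have "summable (\<lambda>j. norm ((1 - x * p ^ j) - 1))"
    using assms by (simp add: abs_mult power_abs summable_geometric summable_mult)
  then show ?thesis
    by (rule abs_convergent_prod_imp_convergent_prod[OF summable_imp_abs_convergent_prod])
qed

lemma qpoch_inf_LIMSEQ:
  assumes "0 < p" "p < 1"
  shows "(\<lambda>n. \<Prod>j<n. 1 - x * p ^ j) \<longlonglongrightarrow> qpoch_inf x p"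
  unfolding qpoch_inf_def
  using convergent_prod_LIMSEQ[OF convergent_prod_qpoch[OF assms, of x]]
    LIMSEQ_lessThan_iff_atMost[of "prod (\<lambda>j. 1 - x * p ^ j)"] by blast

lemma qpoch_inf_rec:
  assumes "0 < p" "p < 1"
  shows "qpoch_inf x p = (1 - x) * qpoch_inf (x * p) p"
proof -
  have "(\<lambda>n. (1 - x) * (\<Prod>j<n. 1 - (x * p) * p ^ j)) \<longlonglongrightarrow> (1 - x) * qpoch_inf (x * p) p"
    by (intro tendsto_intros qpoch_inf_LIMSEQ assms)
  also have "(\<lambda>n. (1 - x) * (\<Prod>j<n. 1 - (x * p) * p ^ j)) = (\<lambda>n. \<Prod>j<Suc n. 1 - x * p ^ j)"
    by (subst prod.lessThan_Suc_shift) (simp add: mult_ac)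
  finally show ?thesis
    by (rule LIMSEQ_unique[OF LIMSEQ_Suc[OF qpoch_inf_LIMSEQ[OF assms, of x]]])
qed

lemma qpoch_inf_nonzero:
  assumes "0 < p" "p < 1" "\<And>j. x * p ^ j \<noteq> 1"
  shows "qpoch_inf x p \<noteq> 0"
  unfolding qpoch_inf_def
  by (rule prodinf_nonzero[OF convergent_prod_qpoch]) (use assms in auto)

lemma qpoch_inf_pos:
  assumes "0 < p" "p < 1" "x \<le> 0"
  shows "qpoch_inf x p > 0"
  unfolding qpoch_inf_def
proof (rule less_0_prodinf[OF convergent_prod_qpoch])
  show "0 < 1 - x * p ^ i" for i
    using mult_nonpos_nonneg[of x "p ^ i"] assms by simp
qed (use assms in auto)

section \<open>Bilateral theta series\<close>

definition tri :: "int \<Rightarrow> int" where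
  "tri k = k * (k - 1) div 2"

lemma two_tri: "2 * tri k = k * (k - 1)"
  unfolding tri_def by (rule dvd_mult_div_cancel) auto

lemma tri_Suc: "tri (k + 1) = tri k + k"
  using two_tri[of k] two_tri[of "k + 1"] by (simp add: algebra_simps)

lemma tri_reflect: "tri (- k) = tri k + k"
  using two_tri[of k] two_tri[of "- k"] by (simp add: algebra_simps)

lemma tri_diff: "tri (k - j) = tri k + tri j + j - k * j"
  using two_tri[of k] two_tri[of "k - j"] two_tri[of j] by (simp add: algebra_simps)

definition theta_term :: "real \<Rightarrow> real \<Rightarrow> int \<Rightarrow> real" where
  "theta_term p x k = x powi k * p powi tri k"

definition theta :: "real \<Rightarrow> real \<Rightarrow> real" where
  "theta p x = (\<Sum>\<^sub>\<infinity>k. theta_term p x k)"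

lemma theta_term_Suc:
  assumes "0 < p" "x \<noteq> 0"
  shows "theta_term p x (k + 1) = x * p powi k * theta_term p x k"
  using assms by (simp add: theta_term_def tri_Suc power_int_add)

lemma theta_term_reflect:
  assumes "0 < p" "x \<noteq> 0"
  shows "theta_term p x (- k) = theta_term p (p / x) k"
  using assms by (simp add: theta_term_def tri_reflect power_int_add power_int_minus
      power_int_divide_distrib field_simps)

lemma summable_on_int_halves:
  fixes f :: "int \<Rightarrow> 'a::banach"
  assumes "summable (\<lambda>n. norm (f (int n)))" "summable (\<lambda>n. norm (f (- int n)))"
  shows "(\<lambda>k. norm (f k)) summable_on UNIV"
proof -
  have "(\<lambda>k. norm (f k)) summable_on range int"
    using assms(1) by (subst summable_on_reindex) (auto simp: o_def summable_nonneg_imp_summable_on)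
  moreover have "(\<lambda>k. norm (f k)) summable_on range (\<lambda>n. - int n)"
    using assms(2) by (subst summable_on_reindex)
      (auto simp: o_def summable_nonneg_imp_summable_on inj_on_def)
  ultimately have "(\<lambda>k. norm (f k)) summable_on (range int \<union> range (\<lambda>n. - int n))"
    by (rule summable_on_union)
  moreover have "range int \<union> range (\<lambda>n. - int n) = UNIV"
    by (auto intro: int_cases2)
  ultimately show ?thesis by simp
qed

lemma summable_theta_half:
  assumes "0 < p" "p < 1" "x \<noteq> 0"
  shows "summable (\<lambda>n. norm (theta_term p x (int n)))"
proof -
  have "(\<lambda>n. \<bar>x\<bar> * p ^ n) \<longlonglongrightarrow> \<bar>x\<bar> * 0"
    using assms by (intro tendsto_intros LIMSEQ_realpow_zero) auto
  then have "eventually (\<lambda>n. \<bar>x\<bar> * p ^ n < 1/2) sequentially"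
    by (rule order_tendstoD) auto
  then obtain N where N: "\<And>n. n \<ge> N \<Longrightarrow> \<bar>x\<bar> * p ^ n < 1/2"
    by (auto simp: eventually_sequentially)
  show ?thesis
  proof (rule summable_ratio_test[of "1/2" N])
    fix n assume "N \<le> n"
    have "theta_term p x (int (Suc n)) = x * p ^ n * theta_term p x (int n)"
      using theta_term_Suc[of p x "int n"] assms by (simp add: add_ac)
    then show "norm (norm (theta_term p x (int (Suc n)))) \<le> 1/2 * norm (norm (theta_term p x (int n)))"
      using mult_right_mono[OF less_imp_le[OF N[OF \<open>N \<le> n\<close>]], of "\<bar>theta_term p x (int n)\<bar>"] assms
      by (simp add: abs_mult power_abs)
  qed auto
qed

text \<open>The ratio \<open>x p\<^sup>k\<close> of consecutive terms tends to \<open>0\<close> on the right, and the reflection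
  \<open>k \<mapsto> -k\<close> turns the left half into a right half with \<open>p / x\<close> in place of \<open>x\<close>.\<close>

lemma theta_term_abs_summable:
  assumes "0 < p" "p < 1" "x \<noteq> 0"
  shows "(\<lambda>k. norm (theta_term p x k)) summable_on UNIV"
  using summable_theta_half[OF assms] summable_theta_half[of p "p / x"] assms
  by (intro summable_on_int_halves) (auto simp: theta_term_reflect)

lemma theta_has_sum:
  assumes "0 < p" "p < 1" "x \<noteq> 0"
  shows "(theta_term p x has_sum theta p x) UNIV"
  unfolding theta_def
  by (rule has_sum_infsum[OF abs_summable_summable[OF theta_term_abs_summable[OF assms]]])

section \<open>Euler's expansion of the shifted factorial\<close>

text \<open>The finite shifted factorial \<open>(p;p)\<^sub>n\<close>.\<close>

definition qfact :: "real \<Rightarrow> nat \<Rightarrow> real" where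
  "qfact p n = (\<Prod>i<n. 1 - p ^ Suc i)"

lemma qfact_0 [simp]: "qfact p 0 = 1"
  and qfact_Suc: "qfact p (Suc n) = qfact p n * (1 - p ^ Suc n)"
  by (simp_all add: qfact_def)

lemma qfact_pos: "0 < p \<Longrightarrow> p < 1 \<Longrightarrow> qfact p n > 0"
  unfolding qfact_def by (intro prod_pos) (auto simp: power_Suc_less_one simp del: power_Suc)

text \<open>The factorials decrease to the positive limit \<open>(p;p)\<^sub>\<infinity>\<close>, so dividing by them never
  spoils absolute convergence.\<close>

lemma qfact_ge:
  assumes "0 < p" "p < 1"
  shows "\<exists>B>0. \<forall>n. qfact p n \<ge> B"
proof (intro exI conjI allI)
  have nz: "p * p ^ j \<noteq> 1" for j
    using power_Suc_less_one[of p j] assms by auto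
  have lim: "(\<lambda>n. qfact p n) \<longlonglongrightarrow> qpoch_inf p p"
    unfolding qfact_def using qpoch_inf_LIMSEQ[OF assms, of p] by simp
  have "decseq (qfact p)"
  proof (rule decseq_SucI)
    show "qfact p (Suc n) \<le> qfact p n" for n
      using mult_left_le[of "1 - p ^ Suc n" "qfact p n"] qfact_pos[OF assms, of n] assms
      by (simp add: qfact_Suc)
  qed
  then show "qfact p n \<ge> qpoch_inf p p" for n
    by (rule decseq_ge[OF _ lim])
  have "qpoch_inf p p \<ge> 0"
    by (rule LIMSEQ_le_const[OF lim]) (meson qfact_pos[OF assms] less_imp_le)
  then show "qpoch_inf p p > 0"
    using qpoch_inf_nonzero[OF assms nz] by simp
qed

lemma summable_div_qfact:
  assumes "0 < p" "p < 1" "summable (\<lambda>n. norm (f n :: real))"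
  shows "summable (\<lambda>n. norm (f n / qfact p n))"
proof -
  obtain B where B: "B > 0" "\<And>n. qfact p n \<ge> B"
    using qfact_ge[OF assms(1,2)] by auto
  show ?thesis
  proof (rule summable_comparison_test'[of "\<lambda>n. norm (f n) / B" 0])
    show "norm (norm (f n / qfact p n)) \<le> norm (f n) / B" for n
      using B(1) B(2)[of n] divide_left_mono[of B "qfact p n" "\<bar>f n\<bar>"] by simp
    show "summable (\<lambda>n. norm (f n) / B)"
      by (rule summable_divide[OF assms(3)])
  qed
qed

text \<open>The coefficient of \<open>z\<^sup>j\<close> in the power series of \<open>(z;p)\<^sub>\<infinity>\<close>.\<close>

definition euler_coeff :: "real \<Rightarrow> nat \<Rightarrow> real" where
  "euler_coeff p j = (-1) ^ j * p powi tri (int j) / qfact p j"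

lemma euler_summable:
  assumes "0 < p" "p < 1"
  shows "summable (\<lambda>j. norm (euler_coeff p j * z ^ j))"
proof (cases "z = 0")
  case True
  then show ?thesis by (intro summable_finite[of "{0}"]) auto
next
  case False
  then show ?thesis
    using summable_div_qfact[OF assms summable_theta_half[OF assms, of "-z"]]
    by (simp add: euler_coeff_def theta_term_def abs_mult power_abs mult_ac)
qed

lemma euler_coeff_Suc:
  assumes "0 < p" "p < 1"
  shows "euler_coeff p (Suc j) * (1 - p ^ Suc j) = - (euler_coeff p j * p ^ j)"
proof -
  have "qfact p j \<noteq> 0"
    using qfact_pos[OF assms, of j] by simp
  moreover
  define r where "r = 1 - p ^ Suc j"
  have "r \<noteq> 0"
    using power_Suc_less_one[of p j] assms unfolding r_def by (simp del: power_Suc)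
  moreover have "p powi tri (int (Suc j)) = p powi tri (int j) * p ^ j"
    using tri_Suc[of "int j"] assms by (simp add: power_int_add add_ac)
  moreover have "euler_coeff p (Suc j) * r
      = (-1) ^ Suc j * p powi tri (int (Suc j)) / (qfact p j * r) * r"
    by (simp only: euler_coeff_def qfact_Suc r_def)
  ultimately show ?thesis
    unfolding r_def[symmetric] by (simp add: euler_coeff_def)
qed

text \<open>The recursion of the coefficients says that the power series \<open>F\<close> satisfies
  \<open>F(z) = (1 - z) F(zp)\<close>, which is also the functional equation of \<open>(z;p)\<^sub>\<infinity>\<close>. Iterating it and using
  continuity at \<open>0\<close>, where \<open>F(0) = 1\<close>, identifies the two.\<close>

lemma euler_expansion:
  assumes p: "0 < p" "p < 1"
  shows "((\<lambda>j. euler_coeff p j * z ^ j) has_sum qpoch_inf z p) UNIV"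
proof -
  define F where "F z = (\<Sum>j. euler_coeff p j * z ^ j)" for z
  have summ: "summable (\<lambda>j. euler_coeff p j * z ^ j)" for z
    by (rule summable_norm_cancel[OF euler_summable[OF p, of z]])
  have c0: "euler_coeff p 0 = 1"
    by (simp add: euler_coeff_def tri_def)
  have eq: "F z = 1 + (\<Sum>j. euler_coeff p (Suc j) * z ^ Suc j)" for z
    unfolding F_def using suminf_split_head[OF summ[of z]] c0 by simp
  have F0: "F 0 = 1"
    unfolding eq[of 0] by simp
  have rec: "F z = (1 - z) * F (z * p)" for z
  proof -
    have s: "summable (\<lambda>j. euler_coeff p (Suc j) * z ^ Suc j)" for z
      using summable_Suc_iff[of "\<lambda>j. euler_coeff p j * z ^ j"] summ[of z] by blast
    have "F z - F (z * p) = (\<Sum>j. euler_coeff p (Suc j) * z ^ Suc j - euler_coeff p (Suc j) * (z * p) ^ Suc j)"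
      unfolding eq[of z] eq[of "z * p"] suminf_diff[OF s s, symmetric] by (rule add_diff_cancel_left)
    also have "(\<lambda>j. euler_coeff p (Suc j) * z ^ Suc j - euler_coeff p (Suc j) * (z * p) ^ Suc j)
       = (\<lambda>j. - z * (euler_coeff p j * (z * p) ^ j))"
    proof
      fix j
      have "euler_coeff p (Suc j) * z ^ Suc j - euler_coeff p (Suc j) * (z * p) ^ Suc j
        = z ^ Suc j * (euler_coeff p (Suc j) * (1 - p ^ Suc j))"
        unfolding power_mult_distrib by (simp add: right_diff_distrib del: power_Suc)
      also have "\<dots> = - z * (euler_coeff p j * (z * p) ^ j)"
        unfolding euler_coeff_Suc[OF p] by (simp add: power_mult_distrib)
      finally show "euler_coeff p (Suc j) * z ^ Suc j - euler_coeff p (Suc j) * (z * p) ^ Suc j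
        = - z * (euler_coeff p j * (z * p) ^ j)" .
    qed
    also have "suminf \<dots> = - z * F (z * p)"
      unfolding F_def by (rule suminf_mult[OF summ])
    finally show ?thesis by (simp add: left_diff_distrib)
  qed
  have iter: "F z = (\<Prod>j<n. 1 - z * p ^ j) * F (z * p ^ n)" for n
  proof (induction n)
    case (Suc n)
    have "F (z * p ^ n) = (1 - z * p ^ n) * F (z * p ^ Suc n)"
      using rec[of "z * p ^ n"] by (simp add: mult.assoc mult.commute[of p])
    with Suc show ?case by simp
  qed simp
  have "isCont F 0"
    unfolding F_def by (rule isCont_powser[of _ 1]) (use summ[of 1] in auto)
  moreover have "(\<lambda>n. z * p ^ n) \<longlonglongrightarrow> 0"
    using tendsto_mult[OF tendsto_const LIMSEQ_realpow_zero[of p], of z] p by simp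
  ultimately have "(\<lambda>n. F (z * p ^ n)) \<longlonglongrightarrow> F 0"
    by (rule isCont_tendsto_compose)
  then have "(\<lambda>n. (\<Prod>j<n. 1 - z * p ^ j) * F (z * p ^ n)) \<longlonglongrightarrow> qpoch_inf z p * F 0"
    by (intro tendsto_mult qpoch_inf_LIMSEQ p)
  then have "(\<lambda>n. F z) \<longlonglongrightarrow> qpoch_inf z p"
    by (simp only: iter[symmetric] F0 mult_1_right)
  then have "F z = qpoch_inf z p"
    by (simp only: LIMSEQ_const_iff)
  moreover have "(\<lambda>j. euler_coeff p j * z ^ j) sums F z"
    unfolding F_def by (rule summable_sums[OF summ])
  ultimately show ?thesis
    using norm_summable_imp_has_sum[OF euler_summable[OF p, of z]] by simp
qed

section \<open>A bilateral sum of Ramanujan type\<close>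

lemma has_sum_mult_product:
  fixes a :: "'i \<Rightarrow> real" and b :: "'j \<Rightarrow> real"
  assumes a: "(\<lambda>i. norm (a i)) summable_on A" and b: "(\<lambda>j. norm (b j)) summable_on B"
  shows "((\<lambda>(i, j). a i * b j) has_sum (infsum a A * infsum b B)) (A \<times> B)"
proof (rule has_sum_SigmaI[where g = "\<lambda>i. a i * infsum b B"])
  show "((\<lambda>j. case (i, j) of (i, j) \<Rightarrow> a i * b j) has_sum a i * infsum b B) B" for i
    using has_sum_cmult_right[OF has_sum_infsum[OF abs_summable_summable[OF b]], of "a i"] by simp
  show "((\<lambda>i. a i * infsum b B) has_sum infsum a A * infsum b B) A"
    by (rule has_sum_cmult_left[OF has_sum_infsum[OF abs_summable_summable[OF a]]])
  have "(\<lambda>(i, j). norm (a i) * norm (b j)) summable_on A \<times> B"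
  proof (rule summable_on_SigmaI[where g = "\<lambda>i. norm (a i) * infsum (\<lambda>j. norm (b j)) B"])
    show "((\<lambda>j. case (i, j) of (i, j) \<Rightarrow> norm (a i) * norm (b j)) has_sum
        norm (a i) * infsum (\<lambda>j. norm (b j)) B) B" for i
      using has_sum_cmult_right[OF has_sum_infsum[OF b], of "norm (a i)"] by simp
    show "(\<lambda>i. norm (a i) * infsum (\<lambda>j. norm (b j)) B) summable_on A"
      by (rule summable_on_cmult_left[OF a])
  qed simp
  also have "(\<lambda>(i, j). norm (a i) * norm (b j)) = (\<lambda>x. norm (case x of (i, j) \<Rightarrow> a i * b j))"
    by (auto simp: fun_eq_iff abs_mult)
  finally show "(\<lambda>(i, j). a i * b j) summable_on A \<times> B"
    by (rule abs_summable_summable)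
qed

text \<open>The product side of Jacobi's triple product, without the factor \<open>(p;p)\<^sub>\<infinity>\<close>.\<close>

definition theta_prod :: "real \<Rightarrow> real \<Rightarrow> real" where
  "theta_prod p y = qpoch_inf y p * qpoch_inf (p / y) p"

text \<open>Replacing \<open>y\<close> by \<open>y p\<^sup>k\<close> moves \<open>k\<close> factors from one of the two infinite products to the other,
  and what is gained or lost on the way is a single theta term. So \<open>1 / (y p\<^sup>k;p)\<^sub>\<infinity>\<close> is a constant times
  a theta term times an infinite product in the numerator, to which Euler's expansion applies.\<close>

lemma theta_prod_shift:
  assumes p: "0 < p" "p < 1" and y: "y \<noteq> 0"
  shows "theta_term p (- y) k * qpoch_inf (p powi (1 - k) / y) p * qpoch_inf (y * p powi k) p
    = theta_prod p y" (is "?g k = _")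
proof -
  have step: "?g (k + 1) = ?g k" for k
  proof -
    have pk: "p powi k \<noteq> 0" using p by simp
    have "p powi (1 - (k + 1)) / y * p = p powi (1 - k) / y"
      using p by (simp add: power_int_diff power_int_minus field_simps)
    then have 1: "qpoch_inf (p powi (1 - (k + 1)) / y) p
        = (1 - 1 / (p powi k * y)) * qpoch_inf (p powi (1 - k) / y) p"
      using qpoch_inf_rec[OF p, of "p powi (1 - (k + 1)) / y"] by (simp add: power_int_minus_divide)
    have 2: "qpoch_inf (y * p powi k) p = (1 - y * p powi k) * qpoch_inf (y * p powi (k + 1)) p"
      using qpoch_inf_rec[OF p, of "y * p powi k"] p by (simp add: power_int_add mult.assoc)
    have 3: "- y * p powi k * (1 - 1 / (p powi k * y)) = 1 - y * p powi k"
      using pk y by (simp add: field_simps)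
    have "?g (k + 1) = (- y * p powi k * (1 - 1 / (p powi k * y))) * theta_term p (- y) k
        * qpoch_inf (p powi (1 - k) / y) p * qpoch_inf (y * p powi (k + 1)) p"
      unfolding 1 using theta_term_Suc[of p "-y" k] p y by simp
    also have "\<dots> = ?g k"
      unfolding 2 3 by (simp only: mult_ac)
    finally show ?thesis .
  qed
  have "?g k = ?g 0"
  proof (induction k rule: int_induct[where k = 0])
    case (step2 i)
    then show ?case using step[of "i - 1"] by simp
  qed (use step in auto)
  then show ?thesis
    by (simp add: theta_term_def tri_def theta_prod_def mult.commute)
qed

text \<open>By Euler, this is \<open>1 / (t;p)\<^sub>\<infinity>\<close> for \<open>\<bar>t\<bar> < 1\<close>.\<close>

definition euler_sum :: "real \<Rightarrow> real \<Rightarrow> real" where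
  "euler_sum p t = (\<Sum>\<^sub>\<infinity>j. t ^ j / qfact p j)"

lemma euler_sum_abs_summable:
  assumes "0 < p" "p < 1" "0 < t" "t < 1"
  shows "(\<lambda>j. norm (t ^ j / qfact p j)) summable_on UNIV"
proof -
  have "summable (\<lambda>j. norm (t ^ j))"
    using assms by (simp add: power_abs summable_geometric)
  from summable_div_qfact[OF assms(1,2) this] show ?thesis
    by (rule summable_nonneg_imp_summable_on) simp
qed

lemma euler_sum_pos:
  assumes "0 < p" "p < 1" "0 < t" "t < 1"
  shows "euler_sum p t > 0"
proof -
  have "(\<Sum>\<^sub>\<infinity>j\<in>{0}. t ^ j / qfact p j) \<le> euler_sum p t"
    unfolding euler_sum_def
    using abs_summable_summable[OF euler_sum_abs_summable[OF assms]] qfact_pos[OF assms(1,2)] assms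
    by (intro infsum_mono_neutral) (auto intro: less_imp_le)
  then show ?thesis by simp
qed

text \<open>Ramanujan's bilateral sum with vanishing lower parameter, its right-hand side written with the theta
  series. By the shift formula the \<open>k\<close>-th term is a constant times
  \<open>t\<^sup>k (-y)\<^sup>k p\<^bsup>k(k-1)/2\<^esup> (p\<^bsup>1-k\<^esup>/y;p)\<^sub>\<infinity>\<close>. After expanding the product by Euler's formula with summation
  index \<open>j\<close>, the exponents of \<open>p\<close> combine to \<open>(k-j)(k-j-1)/2\<close>. In the indices \<open>l = k - j\<close> and \<open>j\<close> the double
  series is therefore a product of two absolutely convergent single series, and Fubini gives the value.\<close>

lemma bilateral_sum:
  assumes p: "0 < p" "p < 1" and t: "0 < t" "t < 1" and y: "y \<noteq> 0"
    and nz: "\<And>k. qpoch_inf (y * p powi k) p \<noteq> 0"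
  shows "((\<lambda>k. t powi k / qpoch_inf (y * p powi k) p) has_sum
      euler_sum p t * theta p (- (y * t)) / theta_prod p y) UNIV"
proof -
  define S where "S = euler_sum p t * theta p (- (y * t))"
  define f where "f = (\<lambda>(k::int, j::nat). theta_term p (- (y * t)) (k - int j) * (t ^ j / qfact p j))"
  have nzt: "- (y * t) \<noteq> 0" using y t by simp
  have "((\<lambda>(l, j). theta_term p (- (y * t)) l * (t ^ j / qfact p j)) has_sum S) (UNIV \<times> UNIV)"
    using has_sum_mult_product[OF theta_term_abs_summable[OF p nzt] euler_sum_abs_summable[OF p t]]
    by (simp add: S_def euler_sum_def theta_def mult.commute)
  also have "?this \<longleftrightarrow> (f has_sum S) (UNIV \<times> UNIV)"
    by (rule has_sum_reindex_bij_witness[of _ "\<lambda>(k, j). (k - int j, j)" "\<lambda>(l, j). (l + int j, j)"])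
      (auto simp: f_def)
  finally have f_sum: "(f has_sum S) (UNIV \<times> UNIV)" .
  have "((\<lambda>k. t powi k * theta_term p (- y) k * qpoch_inf (p powi (1 - k) / y) p) has_sum S) UNIV"
  proof (rule has_sum_SigmaD[OF f_sum])
    fix k :: int
    have "f (k, j) = t powi k * theta_term p (- y) k * (euler_coeff p j * (p powi (1 - k) / y) ^ j)" for j
    proof -
      have e: "tri (k - int j) = tri k + (tri (int j) + (1 - k) * int j)"
        by (simp add: tri_diff algebra_simps)
      have 1: "(p powi (1 - k) / y) ^ j = p powi ((1 - k) * int j) / y ^ j"
        by (simp add: power_divide power_int_power' )
      have 2: "(- (y * t)) powi (k - int j) = t powi k / t ^ j * ((- y) powi k * (-1) ^ j / y ^ j)"
      proof -
        have "(- (y * t)) powi (k - int j) = (t * (- y)) powi k / (t * (- y)) ^ j"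
          using y t by (simp add: power_int_diff mult.commute)
        also have "\<dots> = t powi k / t ^ j * ((- y) powi k / (- y) ^ j)"
          by (simp only: power_int_mult_distrib power_mult_distrib times_divide_times_eq)
        also have "(- y) powi k / (- y) ^ j = (- y) powi k * (-1) ^ j / y ^ j"
          by (cases "even j") (auto simp: power_minus_odd)
        finally show ?thesis .
      qed
      show ?thesis
        unfolding f_def split theta_term_def euler_coeff_def e 1 2
        using p t y by (simp add: power_int_add mult_ac)
    qed
    then show "((\<lambda>j. f (k, j)) has_sum t powi k * theta_term p (- y) k * qpoch_inf (p powi (1 - k) / y) p) UNIV"
      using has_sum_cmult_right[OF euler_expansion[OF p]] by presburger
  qed
  moreover have "t powi k * theta_term p (- y) k * qpoch_inf (p powi (1 - k) / y) p
      = theta_prod p y * (t powi k / qpoch_inf (y * p powi k) p)" for k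
    using theta_prod_shift[OF p y, of k] nz[of k] by (simp add: field_simps)
  ultimately have "((\<lambda>k. theta_prod p y * (t powi k / qpoch_inf (y * p powi k) p)) has_sum S) UNIV"
    by simp
  moreover have "theta_prod p y \<noteq> 0"
  proof -
    have "qpoch_inf y p \<noteq> 0" using nz[of 0] by simp
    moreover have "qpoch_inf (p / y) p \<noteq> 0"
    proof (rule qpoch_inf_nonzero[OF p])
      fix j :: nat
      have "y * p powi (- int (Suc j)) \<noteq> 1"
      proof
        assume "y * p powi (- int (Suc j)) = 1"
        then show False
          using qpoch_inf_rec[OF p, of "y * p powi (- int (Suc j))"] nz[of "- int (Suc j)"] by simp
      qed
      moreover have "p powi (- int (Suc j)) = inverse (p ^ Suc j)"
        by (simp only: power_int_minus power_int_of_nat)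
      ultimately show "p / y * p ^ j \<noteq> 1"
        using p y by (auto simp: field_simps)
    qed
    ultimately show ?thesis by (simp add: theta_prod_def)
  qed
  ultimately show ?thesis
    unfolding S_def by (subst (asm) has_sum_cmult_right_iff) auto
qed

section \<open>Symmetries and zeros of the theta series\<close>

lemma theta_shift:
  assumes p: "0 < p" "p < 1" and x: "x \<noteq> 0"
  shows "theta p x = x * theta p (x * p)"
proof -
  have "((\<lambda>k. theta_term p x (k + 1)) has_sum theta p x) UNIV"
    using theta_has_sum[OF p x]
    by (subst has_sum_reindex_bij_witness[of _ "\<lambda>k. k - 1" "\<lambda>k. k + 1" UNIV "theta_term p x"]) auto
  moreover have "theta_term p x (k + 1) = x * theta_term p (x * p) k" for k
    using p x by (simp add: theta_term_Suc) (simp add: theta_term_def power_int_mult_distrib)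
  ultimately have "((\<lambda>k. x * theta_term p (x * p) k) has_sum theta p x) UNIV"
    by simp
  moreover have "((\<lambda>k. x * theta_term p (x * p) k) has_sum x * theta p (x * p)) UNIV"
    by (rule has_sum_cmult_right[OF theta_has_sum[OF p]]) (use p x in auto)
  ultimately show ?thesis by (rule has_sum_unique)
qed

text \<open>The even and the odd terms of the series are theta series in base \<open>p\<^sup>4\<close> themselves. Their arguments are
  those in the moments of degree \<open>0\<close> and \<open>2\<close>.\<close>

lemma theta_dissection:
  assumes p: "0 < p" "p < 1" and x: "x \<noteq> 0"
  shows "theta p x = theta (p ^ 4) (x ^ 2 * p) + x * theta (p ^ 4) (x ^ 2 * p ^ 3)"
proof -
  have p4: "0 < p ^ 4" "p ^ 4 < 1" using p power_Suc_less_one[of p 3] by (simp_all add: numeral_eq_Suc)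
  have four: "(p ^ 4) powi m = p powi (4 * m)" for m
    by (simp add: power_int_power)
  have e: "theta_term p x (2 * l) = theta_term (p ^ 4) (x ^ 2 * p) l" for l
  proof -
    have "tri (2 * l) = l + 4 * tri l"
      using two_tri[of l] two_tri[of "2 * l"] by (simp add: algebra_simps)
    then show ?thesis
      using p x by (simp add: theta_term_def four power_int_mult_distrib power_int_add
        power_int_power mult_ac)
  qed
  have o: "theta_term p x (2 * l + 1) = x * theta_term (p ^ 4) (x ^ 2 * p ^ 3) l" for l
  proof -
    have "tri (2 * l + 1) = 3 * l + 4 * tri l"
      using two_tri[of l] two_tri[of "2 * l + 1"] by (simp add: algebra_simps)
    then show ?thesis
      using p x by (simp add: theta_term_def four power_int_mult_distrib power_int_add
        power_int_power mult_ac)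
  qed
  have "((theta_term p x \<circ> (\<lambda>l. 2 * l)) has_sum theta (p ^ 4) (x ^ 2 * p)) UNIV"
    using theta_has_sum[OF p4, of "x ^ 2 * p"] p x by (simp add: o_def e)
  then have 1: "(theta_term p x has_sum theta (p ^ 4) (x ^ 2 * p)) (range (\<lambda>l. 2 * l))"
    by (subst has_sum_reindex) (auto simp: inj_on_def)
  have "((theta_term p x \<circ> (\<lambda>l. 2 * l + 1)) has_sum x * theta (p ^ 4) (x ^ 2 * p ^ 3)) UNIV"
    using has_sum_cmult_right[OF theta_has_sum[OF p4, of "x ^ 2 * p ^ 3"], of x] p x
    by (simp add: o_def o)
  then have 2: "(theta_term p x has_sum x * theta (p ^ 4) (x ^ 2 * p ^ 3)) (range (\<lambda>l. 2 * l + 1))"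
    by (subst has_sum_reindex) (auto simp: inj_on_def)
  have "range (\<lambda>l. 2 * l) \<inter> range (\<lambda>l. 2 * l + 1) = ({} :: int set)"
    by (auto; presburger)
  moreover have "range (\<lambda>l. 2 * l) \<union> range (\<lambda>l. 2 * l + 1) = (UNIV :: int set)"
    by (auto simp: image_iff; presburger)
  ultimately show ?thesis
    using has_sum_unique[OF theta_has_sum[OF p x]] has_sum_Un_disjoint[OF 1 2] by simp
qed

text \<open>Substituting \<open>l \<mapsto> -l - a\<close>; it is the reason why the even moments for \<open>c = 1\<close> and \<open>c = q\<^bsup>1/2\<^esup>\<close>
  are proportional.\<close>

lemma theta_odd_power_reflect:
  fixes a :: nat
  assumes p: "0 < p" "p < 1"
  shows "p ^ a * theta (p ^ 4) (p ^ (2 * a + 3)) = theta (p ^ 4) (p ^ (2 * a + 1))"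
proof -
  have p4: "0 < p ^ 4" "p ^ 4 < 1" using p power_Suc_less_one[of p 3] by (simp_all add: numeral_eq_Suc)
  have eq: "theta_term (p ^ 4) (p ^ m) l = p powi (int m * l + 4 * tri l)" for m l
    using p by (simp add: theta_term_def power_int_power power_int_add)
  have "theta_term (p ^ 4) (p ^ (2 * a + 1)) l = p ^ a * theta_term (p ^ 4) (p ^ (2 * a + 3)) (- l - int a)" for l
  proof -
    have "int (2 * a + 1) * l + 4 * tri l = int a + (int (2 * a + 3) * (- l - int a) + 4 * tri (- l - int a))"
      using two_tri[of l] two_tri[of "- l - int a"] by (simp add: algebra_simps)
    then show ?thesis
      unfolding eq using p by (simp add: power_int_add)
  qed
  moreover have "((\<lambda>l. p ^ a * theta_term (p ^ 4) (p ^ (2 * a + 3)) (- l - int a)) has_sum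
      p ^ a * theta (p ^ 4) (p ^ (2 * a + 3))) UNIV"
  proof (rule has_sum_cmult_right)
    show "((\<lambda>l. theta_term (p ^ 4) (p ^ (2 * a + 3)) (- l - int a)) has_sum
      theta (p ^ 4) (p ^ (2 * a + 3))) UNIV"
      using theta_has_sum[OF p4, of "p ^ (2 * a + 3)"] p
      by (subst has_sum_reindex_bij_witness[of _ "\<lambda>l. - l - int a" "\<lambda>l. - l - int a" UNIV
          "theta_term (p ^ 4) (p ^ (2 * a + 3))"]) auto
  qed
  ultimately have "(theta_term (p ^ 4) (p ^ (2 * a + 1)) has_sum p ^ a * theta (p ^ 4) (p ^ (2 * a + 3))) UNIV"
    by presburger
  then show ?thesis
    using theta_has_sum[OF p4, of "p ^ (2 * a + 1)"] p
    by (intro has_sum_unique[of "theta_term (p ^ 4) (p ^ (2 * a + 1))"]) auto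
qed

lemma has_sum_int_symmetric_LIMSEQ:
  assumes "(g has_sum S) (UNIV :: int set)"
  shows "(\<lambda>n. \<Sum>k\<in>{- int n..<int n}. g k) \<longlonglongrightarrow> S"
proof (rule filterlim_compose[of "sum g"])
  show "(sum g \<longlongrightarrow> S) (finite_subsets_at_top UNIV)"
    using assms by (simp add: has_sum_def)
  show "filterlim (\<lambda>n. {- int n..<int n}) (finite_subsets_at_top UNIV) sequentially"
    unfolding filterlim_finite_subsets_at_top
  proof (intro allI impI)
    fix X :: "int set" assume "finite X \<and> X \<subseteq> UNIV"
    then have M: "\<bar>x\<bar> \<le> Max (abs ` X)" if "x \<in> X" for x
      using that by (intro Max_ge) auto
    have "X \<subseteq> {- int n..<int n}" if "n \<ge> nat (Max (abs ` X) + 1)" for n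
    proof
      fix x assume "x \<in> X"
      from that have "Max (abs ` X) + 1 \<le> int n" by linarith
      with M[OF \<open>x \<in> X\<close>] show "x \<in> {- int n..<int n}" by auto
    qed
    then show "\<forall>\<^sub>F n in sequentially. finite {- int n..<int n} \<and> X \<subseteq> {- int n..<int n}
        \<and> {- int n..<int n} \<subseteq> UNIV"
      by (auto simp: eventually_sequentially)
  qed
qed

text \<open>For \<open>t = p\<close> the bilateral sum telescopes: with \<open>f k = 1 / (u p\<^sup>k;p)\<^sub>\<infinity>\<close> one has
  \<open>f (k + 1) - f k = - u p\<^sup>k f k\<close>, while \<open>f\<close> tends to \<open>1\<close> on the right and to \<open>0\<close> on the left. So the sum is
  nonzero, and with it the theta series. (Written out, this argument proves Jacobi's triple product.)\<close>

lemma theta_nonzero: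
  assumes p: "0 < p" "p < 1" and u: "u \<noteq> 0"
    and nz: "\<And>k. qpoch_inf (u * p powi k) p \<noteq> 0"
  shows "theta p (- u) \<noteq> 0"
proof
  assume "theta p (- u) = 0"
  then have "theta p (- (u * p)) = 0"
    using theta_shift[OF p, of "- u"] u by simp
  then have sum0: "((\<lambda>k. p powi k / qpoch_inf (u * p powi k) p) has_sum 0) UNIV"
    using bilateral_sum[OF p p u nz] by simp
  define f where "f k = 1 / qpoch_inf (u * p powi k) p" for k
  have step: "f (k + 1) - f k = - u * (p powi k / qpoch_inf (u * p powi k) p)" for k
  proof -
    have r: "qpoch_inf (u * p powi k) p = (1 - u * p powi k) * qpoch_inf (u * p powi (k + 1)) p"
      using qpoch_inf_rec[OF p, of "u * p powi k"] p by (simp add: power_int_add mult.assoc)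
    then have "1 - u * p powi k \<noteq> 0" using nz[of k] by auto
    with r have "f (k + 1) = (1 - u * p powi k) * f k"
      using nz[of "k + 1"] by (simp add: f_def)
    then have "f (k + 1) - f k = - (u * p powi k) * f k"
      by (simp add: left_diff_distrib)
    then show ?thesis by (simp add: f_def)
  qed
  have tele: "(\<Sum>k\<in>{- int n..<int n}. f (k + 1) - f k) = f (int n) - f (- int n)" for n
  proof (induction n)
    case (Suc n)
    have "{- int (Suc n)..<int (Suc n)} = insert (- 1 - int n) (insert (int n) {- int n..<int n})"
      by auto
    with Suc show ?case by (simp add: add.commute)
  qed simp
  have "(\<lambda>n. f (int n) - f (- int n)) \<longlonglongrightarrow> 0"
    using has_sum_int_symmetric_LIMSEQ[OF has_sum_cmult_right[OF sum0, of "- u"]]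
    unfolding step[symmetric] tele by simp
  moreover have "(\<lambda>n. f (int n) - f (- int n)) \<longlonglongrightarrow> 1 - 0"
  proof (rule tendsto_diff)
    \<comment> \<open>On the right, the partial products of \<open>(u;p)\<^sub>\<infinity>\<close> exhaust it.\<close>
    have fin: "qpoch_inf u p = (\<Prod>j<n. 1 - u * p ^ j) * qpoch_inf (u * p ^ n) p" for n
    proof (induction n)
      case (Suc n)
      have "qpoch_inf (u * p ^ n) p = (1 - u * p ^ n) * qpoch_inf (u * p ^ Suc n) p"
        using qpoch_inf_rec[OF p, of "u * p ^ n"] by (simp add: mult.assoc mult.commute[of p])
      with Suc show ?case by simp
    qed simp
    have nz0: "qpoch_inf u p \<noteq> 0" using nz[of 0] by simp
    have "f (int n) = (\<Prod>j<n. 1 - u * p ^ j) / qpoch_inf u p" for n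
      using fin[of n] nz0 by (auto simp: f_def)
    moreover have "(\<lambda>n. (\<Prod>j<n. 1 - u * p ^ j) / qpoch_inf u p) \<longlonglongrightarrow> qpoch_inf u p / qpoch_inf u p"
      by (intro tendsto_divide qpoch_inf_LIMSEQ p tendsto_const nz0)
    ultimately show "(\<lambda>n. f (int n)) \<longlonglongrightarrow> 1"
      using nz0 by simp
    \<comment> \<open>On the left, already \<open>p\<^bsup>-n\<^esup> f(-n)\<close> tends to \<open>0\<close>, being a term of a convergent series.\<close>
    have "(\<lambda>n. p powi (- int n) * f (- int n)) summable_on UNIV"
    proof -
      have "(\<lambda>k. p powi k / qpoch_inf (u * p powi k) p) summable_on range (\<lambda>n. - int n)"
        by (rule summable_on_subset_banach[OF has_sum_imp_summable[OF sum0]]) simp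
      then show ?thesis
        by (subst (asm) summable_on_reindex) (auto simp: inj_on_def o_def f_def)
    qed
    then have "(\<lambda>n. p powi (- int n) * f (- int n)) \<longlonglongrightarrow> 0"
      by (rule summable_LIMSEQ_zero[OF summable_on_imp_summable])
    moreover have "(\<lambda>n. p ^ n) \<longlonglongrightarrow> 0"
      using p by (intro LIMSEQ_realpow_zero) auto
    ultimately have "(\<lambda>n. p ^ n * (p powi (- int n) * f (- int n))) \<longlonglongrightarrow> 0 * 0"
      by (intro tendsto_mult)
    then show "(\<lambda>n. f (- int n)) \<longlonglongrightarrow> 0"
      using p by (simp add: power_int_minus flip: mult.assoc)
  qed
  ultimately have "0 = (1 - 0 :: real)"
    by (rule LIMSEQ_unique)
  then show False by simp
qed

section \<open>Moments of the weight\<close>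

lemma weight_even: "weight q (- x) = weight q x"
  by (simp add: weight_def)

lemma power4_bounds:
  fixes q :: real
  assumes "0 < q" "q < 1"
  shows "0 < q ^ 4" "q ^ 4 < 1"
  using assms power_Suc_less_one[of q 3] by (simp_all add: numeral_eq_Suc)

lemma weight_pos:
  assumes "0 < q" "q < 1"
  shows "weight q x > 0"
  using qpoch_inf_pos[OF power4_bounds[OF assms], of "- (x ^ 4)"] by (simp add: weight_def)

lemma has_sum_pos:
  fixes f :: "'a \<Rightarrow> real"
  assumes "(f has_sum S) UNIV" "\<And>x. f x > 0"
  shows "S > 0"
proof -
  have "(f has_sum f undefined) {undefined}"
    using has_sum_finite[of "{undefined}" f] by simp
  from has_sum_mono'[OF this assms(1)] assms(2) have "f undefined \<le> S"
    by (simp add: less_imp_le)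
  with assms(2)[of undefined] show ?thesis by simp
qed

text \<open>The closed form of \<open>\<Sum>\<^sub>k x\<^sup>n w(x)\<close> over \<open>x = c q\<^sup>k\<close>, for positive \<open>n\<close>. The bilateral sum produces it
  with base \<open>q\<^sup>4\<close>, \<open>t = q\<^sup>n\<close> and \<open>y = - c\<^sup>4\<close>.\<close>

definition jackson_moment :: "real \<Rightarrow> real \<Rightarrow> nat \<Rightarrow> real" where
  "jackson_moment q c n = c ^ n * (euler_sum (q ^ 4) (q ^ n) * theta (q ^ 4) (c ^ 4 * q ^ n)
     / theta_prod (q ^ 4) (- (c ^ 4)))"

lemma jackson_moment_has_sum:
  assumes q: "0 < q" "q < 1" and c: "c > 0" and n: "n > 0"
  shows "((\<lambda>k. (c * q powi k) ^ n * weight q (c * q powi k)) has_sum jackson_moment q c n) UNIV"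
proof -
  note Q = power4_bounds[OF q]
  have qn: "0 < q ^ n" "q ^ n < 1"
    using q n by (simp_all add: power_less_one_iff)
  have nz: "qpoch_inf (- (c ^ 4) * (q ^ 4) powi k) (q ^ 4) \<noteq> 0" for k
    using qpoch_inf_pos[OF Q, of "- (c ^ 4) * (q ^ 4) powi k"] q c by simp
  have "((\<lambda>k. c ^ n * ((q ^ n) powi k / qpoch_inf (- (c ^ 4) * (q ^ 4) powi k) (q ^ 4)))
      has_sum jackson_moment q c n) UNIV"
    using has_sum_cmult_right[OF bilateral_sum[OF Q qn _ nz], of "c ^ n"] c
    by (simp add: jackson_moment_def)
  moreover have "c ^ n * ((q ^ n) powi k / qpoch_inf (- (c ^ 4) * (q ^ 4) powi k) (q ^ 4))
      = (c * q powi k) ^ n * weight q (c * q powi k)" for k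
    by (simp add: weight_def power_mult_distrib power_int_power power_int_power' mult.commute)
  ultimately show ?thesis by simp
qed

lemma jackson_moment_pos:
  assumes q: "0 < q" "q < 1" and c: "c > 0" and n: "n > 0"
  shows "jackson_moment q c n > 0"
  by (rule has_sum_pos[OF jackson_moment_has_sum[OF assms]]) (use weight_pos[OF q] q c in simp)

text \<open>The factor \<open>q\<^sup>k\<close> of the \<open>q\<close>-integral is \<open>x / c\<close> at the node \<open>x = c q\<^sup>k\<close>. It raises the degree by one,
  and the two nodes \<open>\<plusminus>x\<close> double the even moments and cancel the odd ones.\<close>

definition dq_moment :: "real \<Rightarrow> real \<Rightarrow> nat \<Rightarrow> real" where
  "dq_moment q c i = (if even i then 2 / c * jackson_moment q c (Suc i) else 0)"

lemma dq_moment_has_integral: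
  assumes q: "0 < q" "q < 1" and c: "c > 0"
  shows "has_dq_integral q (\<lambda>x. (c * x) ^ i * weight q (c * x)) (dq_moment q c i)"
proof (cases "even i")
  case True
  have "((\<lambda>k. 2 / c * ((c * q powi k) ^ Suc i * weight q (c * q powi k))) has_sum dq_moment q c i) UNIV"
    using has_sum_cmult_right[OF jackson_moment_has_sum[OF q c, of "Suc i"], of "2 / c"] True
    by (simp add: dq_moment_def)
  then show ?thesis
    unfolding has_dq_integral_def using True c by (simp add: weight_even mult_ac)
next
  case False
  then show ?thesis
    unfolding has_dq_integral_def by (simp add: weight_even dq_moment_def)
qed

section \<open>Orthogonal polynomials of a moment functional\<close>

definition moment_functional :: "(nat \<Rightarrow> real) \<Rightarrow> real poly \<Rightarrow> real" where
  "moment_functional M p = (\<Sum>i\<le>degree p. coeff p i * M i)"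

lemma moment_functional_eq:
  assumes "degree p \<le> N"
  shows "moment_functional M p = (\<Sum>i\<le>N. coeff p i * M i)"
  unfolding moment_functional_def
  by (rule sum.mono_neutral_left) (use assms in \<open>auto simp: coeff_eq_0\<close>)

lemma moment_functional_add:
  "moment_functional M (p + r) = moment_functional M p + moment_functional M r"
proof -
  define N where "N = max (degree p) (degree r)"
  have "degree p \<le> N" "degree r \<le> N" "degree (p + r) \<le> N"
    by (auto simp: N_def degree_add_le_max)
  then show ?thesis
    by (simp add: moment_functional_eq[of _ N] sum.distrib algebra_simps)
qed

lemma moment_functional_smult:
  "moment_functional M (smult a p) = a * moment_functional M p"
  using moment_functional_eq[of "smult a p" "degree p" M]
  by (simp add: moment_functional_def sum_distrib_left mult.assoc)

lemma moment_functional_diff: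
  "moment_functional M (p - r) = moment_functional M p - moment_functional M r"
  using moment_functional_add[of M "p - r" r] by simp

lemma moment_functional_scale:
  "moment_functional (\<lambda>i. a * M i) p = a * moment_functional M p"
  by (simp add: moment_functional_def sum_distrib_left mult_ac)

lemma has_sum_finite_sum:
  fixes f :: "'i \<Rightarrow> 'k \<Rightarrow> real"
  assumes "finite I" "\<And>i. i \<in> I \<Longrightarrow> (f i has_sum s i) A"
  shows "((\<lambda>k. \<Sum>i\<in>I. f i k) has_sum (\<Sum>i\<in>I. s i)) A"
  using assms by (induction I rule: finite_induct) (auto intro: has_sum_add)

lemma moment_functional_has_integral:
  assumes q: "0 < q" "q < 1" and c: "c > 0"
  shows "has_dq_integral q (\<lambda>x. poly p (c * x) * weight q (c * x))
    (moment_functional (dq_moment q c) p)"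
proof -
  have "((\<lambda>k. \<Sum>i\<le>degree p. coeff p i * (q powi k * ((c * q powi k) ^ i * weight q (c * q powi k)
        + (c * - (q powi k)) ^ i * weight q (c * - (q powi k)))))
      has_sum moment_functional (dq_moment q c) p) UNIV"
    unfolding moment_functional_def
    using dq_moment_has_integral[OF q c, unfolded has_dq_integral_def]
    by (intro has_sum_finite_sum has_sum_cmult_right) auto
  also have "(\<lambda>k. \<Sum>i\<le>degree p. coeff p i * (q powi k * ((c * q powi k) ^ i * weight q (c * q powi k)
        + (c * - (q powi k)) ^ i * weight q (c * - (q powi k)))))
      = (\<lambda>k. q powi k * (poly p (c * q powi k) * weight q (c * q powi k)
        + poly p (c * - (q powi k)) * weight q (c * - (q powi k))))"
    by (rule ext) (simp only: poly_altdef sum_distrib_left sum_distrib_right sum.distrib ring_distribs mult_ac)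
  finally show ?thesis
    unfolding has_dq_integral_def .
qed

text \<open>If the integral of the square vanishes, then \<open>d\<close> vanishes at all the nodes \<open>c q\<^sup>k\<close>, which are infinitely many.\<close>

lemma moment_functional_definite:
  assumes q: "0 < q" "q < 1" and c: "c > 0"
    and zero: "moment_functional (dq_moment q c) (d * d) = 0"
  shows "d = 0"
proof -
  define g where "g k = q powi k * (poly (d * d) (c * q powi k) * weight q (c * q powi k)
        + poly (d * d) (c * - (q powi k)) * weight q (c * - (q powi k)))" for k
  have sum0: "(g has_sum 0) UNIV"
    using moment_functional_has_integral[OF q c, of "d * d"] zero
    unfolding g_def has_dq_integral_def by simp
  have root: "poly d (c * q powi k) = 0" for k
  proof -
    have nn: "0 \<le> poly (d * d) x * weight q x" for x
      using weight_pos[OF q, of x] by simp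
    have "g k = 0"
      by (rule nonneg_has_sum_le_0D[OF sum0])
        (use nn q in \<open>auto simp: g_def simp del: poly_mult intro!: mult_nonneg_nonneg add_nonneg_nonneg\<close>)
    then have "poly (d * d) (c * q powi k) * weight q (c * q powi k)
        + poly (d * d) (c * - (q powi k)) * weight q (c * - (q powi k)) = 0"
      using q by (simp add: g_def)
    then have "poly (d * d) (c * q powi k) * weight q (c * q powi k) = 0"
      using nn[of "c * q powi k"] nn[of "c * - (q powi k)"] by linarith
    then show ?thesis
      using weight_pos[OF q, of "c * q powi k"] by simp
  qed
  have "inj (\<lambda>n::nat. c * q ^ n)"
    using q c by (auto simp: inj_on_def power_inject_exp')
  then have "infinite (range (\<lambda>n::nat. c * q ^ n))"
    by (simp add: range_inj_infinite)
  moreover have "range (\<lambda>n::nat. c * q ^ n) \<subseteq> {x. poly d x = 0}"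
    using root[of "int _"] by auto
  ultimately have "infinite {x. poly d x = 0}"
    using finite_subset by blast
  then show ?thesis
    using poly_roots_finite by blast
qed

definition orthogonal_family :: "(nat \<Rightarrow> real) \<Rightarrow> (nat \<Rightarrow> real poly) \<Rightarrow> bool" where
  "orthogonal_family M P \<longleftrightarrow> (\<forall>n. degree (P n) = n \<and> lead_coeff (P n) = 1)
     \<and> (\<forall>n m. n \<noteq> m \<longrightarrow> moment_functional M (P n * P m) = 0)"

text \<open>Subtracting a multiple of \<open>P m\<close> removes the coefficient of degree \<open>m\<close> from \<open>r\<close>.\<close>

lemma orthogonal_family_lower:
  assumes P: "orthogonal_family M P"
  shows "m \<le> n \<Longrightarrow> (\<And>i. i \<ge> m \<Longrightarrow> coeff r i = 0) \<Longrightarrow> moment_functional M (P n * r) = 0"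
proof (induction m arbitrary: r)
  case 0
  then have "r = 0" by (simp add: poly_eq_iff)
  then show ?case by (simp add: moment_functional_def)
next
  case (Suc m)
  define r' where "r' = r - smult (coeff r m) (P m)"
  have deg: "degree (P m) = m" and lead: "coeff (P m) m = 1"
    using P unfolding orthogonal_family_def by metis+
  have "coeff r' i = 0" if "i \<ge> m" for i
    using that Suc.prems(2)[of i] deg lead coeff_eq_0[of "P m" i]
    by (cases "i = m") (auto simp: r'_def)
  then have "moment_functional M (P n * r') = 0"
    using Suc.IH Suc.prems(1) by simp
  moreover have "P n * r = P n * r' + smult (coeff r m) (P n * P m)"
    by (simp add: r'_def algebra_simps)
  moreover have "moment_functional M (P n * P m) = 0"
    using P Suc.prems(1) unfolding orthogonal_family_def by auto
  ultimately show ?case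
    by (simp add: moment_functional_add moment_functional_smult)
qed

text \<open>The difference \<open>d\<close> of the two members of degree \<open>n\<close> has lower degree, since both are monic. Hence both are
  orthogonal to \<open>d\<close>, which is therefore orthogonal to itself.\<close>

lemma orthogonal_family_unique:
  assumes P: "orthogonal_family M P" and R: "orthogonal_family M R"
    and definite: "\<And>d. moment_functional M (d * d) = 0 \<Longrightarrow> d = 0"
  shows "P = R"
proof
  fix n
  define d where "d = P n - R n"
  have "degree (P n) = n" "degree (R n) = n" "coeff (P n) n = 1" "coeff (R n) n = 1"
    using P R unfolding orthogonal_family_def by metis+
  then have "coeff d i = 0" if "i \<ge> n" for i
    using that coeff_eq_0[of "P n" i] coeff_eq_0[of "R n" i]
    by (cases "i = n") (auto simp: d_def)
  then have "moment_functional M (P n * d) = 0" "moment_functional M (R n * d) = 0"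
    using orthogonal_family_lower[OF P order_refl] orthogonal_family_lower[OF R order_refl] by auto
  moreover have "d * d = P n * d - R n * d"
    by (simp add: d_def algebra_simps)
  ultimately have "moment_functional M (d * d) = 0"
    by (simp add: moment_functional_diff)
  then show "P n = R n"
    using definite[of d] by (simp add: d_def)
qed

section \<open>Dependence of the moments on the dilation\<close>

lemma theta_pos:
  assumes "0 < p" "p < 1" "x > 0"
  shows "theta p x > 0"
  by (rule has_sum_pos[OF theta_has_sum]) (use assms in \<open>auto simp: theta_term_def\<close>)

lemma theta_prod_neg_pos:
  assumes "0 < p" "p < 1" "y > 0"
  shows "theta_prod p (- y) > 0"
  unfolding theta_prod_def
  by (intro mult_pos_pos qpoch_inf_pos) (use assms in \<open>auto simp: divide_le_0_iff\<close>)

text \<open>In degree \<open>2a\<close> the dilation by \<open>q\<^bsup>1/2\<^esup>\<close> contributes \<open>q\<^sup>a\<close>, the power that the reflected theta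
  series absorbs. What remains does not depend on the degree.\<close>

lemma dq_moment_sqrt:
  assumes q: "0 < q" "q < 1"
  shows "dq_moment q (sqrt q) i
    = theta_prod (q ^ 4) (- 1) / theta_prod (q ^ 4) (- (q ^ 2)) * dq_moment q 1 i"
proof (cases "even i")
  case False
  then show ?thesis by (simp add: dq_moment_def)
next
  case True
  then obtain a where i: "i = 2 * a" by (elim evenE)
  note Q = power4_bounds[OF q]
  have pos: "theta_prod (q ^ 4) (- 1) > 0" "theta_prod (q ^ 4) (- (q ^ 2)) > 0"
    using theta_prod_neg_pos[OF Q] q by auto
  have "sqrt q ^ 4 = (sqrt q ^ 2) ^ 2" by (simp only: power_mult[symmetric]) simp
  then have s4: "sqrt q ^ 4 = q ^ 2" using q by simp
  have so: "sqrt q ^ Suc (2 * a) = q ^ a * sqrt q"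
    using q by (simp add: power_mult)
  have "q ^ 2 * q ^ Suc (2 * a) = q ^ (2 * a + 3)"
    by (simp add: power_add[symmetric] eval_nat_numeral)
  then have "sqrt q ^ Suc (2 * a) * theta (q ^ 4) (sqrt q ^ 4 * q ^ Suc (2 * a))
      = sqrt q * theta (q ^ 4) (q ^ Suc (2 * a))"
    unfolding s4 so using theta_odd_power_reflect[OF q, of a] by simp
  then have "jackson_moment q (sqrt q) (Suc (2 * a)) = sqrt q * (euler_sum (q ^ 4) (q ^ Suc (2 * a))
      * theta (q ^ 4) (q ^ Suc (2 * a)) / theta_prod (q ^ 4) (- (q ^ 2)))"
    unfolding jackson_moment_def s4 by (simp add: mult_ac del: power_Suc)
  moreover have "jackson_moment q 1 (Suc (2 * a)) = euler_sum (q ^ 4) (q ^ Suc (2 * a))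
      * theta (q ^ 4) (q ^ Suc (2 * a)) / theta_prod (q ^ 4) (- 1)"
    unfolding jackson_moment_def by (simp del: power_Suc)
  ultimately show ?thesis
    unfolding i dq_moment_def using pos q by (simp del: power_Suc)
qed

text \<open>Equality of the ratios means that \<open>c\<^sup>2 \<theta>(c\<^sup>4q\<^sup>3) = \<theta>(c\<^sup>4q)\<close> in base \<open>q\<^sup>4\<close>, the reflection
  \<open>\<theta>(q\<^sup>3) = \<theta>(q)\<close> giving the value at \<open>1\<close>. By the dissection it says that the theta series in base \<open>q\<close>
  vanishes at \<open>- c\<^sup>2\<close>, which forces \<open>c\<^sup>2\<close> to be an integral power of \<open>q\<close>. But \<open>q\<close> is the only such power
  strictly between \<open>q\<^sup>2\<close> and \<open>1\<close>.\<close>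

lemma moment_ratio_distinct:
  assumes q: "0 < q" "q < 1" and c: "q < c" "c < 1" "c \<noteq> sqrt q"
  shows "dq_moment q c 2 / dq_moment q c 0 \<noteq> dq_moment q 1 2 / dq_moment q 1 0"
proof
  assume eq: "dq_moment q c 2 / dq_moment q c 0 = dq_moment q 1 2 / dq_moment q 1 0"
  note Q = power4_bounds[OF q]
  have c0: "c > 0" using q c by simp
  define E where "E n = euler_sum (q ^ 4) (q ^ n)" for n
  have E: "E 1 > 0" "E 3 > 0"
    using euler_sum_pos[OF Q] q power_Suc_less_one[of q 2]
    by (auto simp: E_def numeral_eq_Suc)
  have refl: "theta (q ^ 4) (q ^ 3) = theta (q ^ 4) q"
    using theta_odd_power_reflect[OF q, of 0] by simp
  have pos: "theta (q ^ 4) q > 0" "theta (q ^ 4) (c ^ 4 * q) > 0" "theta (q ^ 4) (c ^ 4 * q ^ 3) > 0"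
    using theta_pos[OF Q] q c0 by auto
  have ratio: "dq_moment q d 2 / dq_moment q d 0
      = E 3 / E 1 * (d ^ 2 * theta (q ^ 4) (d ^ 4 * q ^ 3) / theta (q ^ 4) (d ^ 4 * q))"
    if d: "d > 0" for d
  proof -
    have "theta_prod (q ^ 4) (- (d ^ 4)) > 0"
      by (rule theta_prod_neg_pos[OF Q]) (use d in simp)
    then show ?thesis
      using d by (simp add: dq_moment_def jackson_moment_def E_def eval_nat_numeral)
  qed
  have "c ^ 2 * theta (q ^ 4) (c ^ 4 * q ^ 3) / theta (q ^ 4) (c ^ 4 * q) = 1"
  proof -
    have "dq_moment q 1 2 / dq_moment q 1 0 = E 3 / E 1"
      using ratio[of 1] refl pos by simp
    moreover have "E 3 / E 1 \<noteq> 0"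
      using E by simp
    ultimately show ?thesis
      using eq unfolding ratio[OF c0] by (metis mult_cancel_left1)
  qed
  then have "c ^ 2 * theta (q ^ 4) (c ^ 4 * q ^ 3) = theta (q ^ 4) (c ^ 4 * q)"
    using pos by (simp add: field_simps)
  moreover have "theta q (- (c ^ 2)) = theta (q ^ 4) (c ^ 4 * q) - c ^ 2 * theta (q ^ 4) (c ^ 4 * q ^ 3)"
    using theta_dissection[OF q, of "- (c ^ 2)"] c0 by (simp add: power_mult[symmetric])
  ultimately have zero: "theta q (- (c ^ 2)) = 0" by simp
  have nodes: "c ^ 2 * q powi m \<noteq> 1" for m
  proof
    assume *: "c ^ 2 * q powi m = 1"
    have c2: "c ^ 2 < 1" "q ^ 2 < c ^ 2"
      using c c0 q power_strict_mono[of c 1 2] power_strict_mono[of q c 2] by auto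
    consider "m \<ge> 0" | "m = -1" | "m \<le> -2" by linarith
    then show False
    proof cases
      case 1
      then have "q powi m \<le> 1"
        using q by (simp add: power_int_def power_le_one)
      then have "c ^ 2 * q powi m \<le> c ^ 2 * 1" by (intro mult_left_mono) auto
      then show False using * c2 by simp
    next
      case 2
      then have "c ^ 2 = q" using * q by (simp add: power_int_minus field_simps)
      then have "sqrt q = c" using c0 by (simp add: real_sqrt_unique)
      then show False using c by simp
    next
      case 3
      have "q ^ 2 * q powi m = q powi (m + 2)" using q by (simp add: power_int_add)
      also have "\<dots> = inverse (q ^ nat (- (m + 2)))"
        using 3 q by (cases "m = -2") (simp_all add: power_int_def power_inverse)
      also have "\<dots> \<ge> 1"
        using q by (intro one_le_inverse) (auto intro: power_le_one)
      finally have "q ^ 2 * q powi m \<ge> 1" .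
      moreover have "q ^ 2 * q powi m < c ^ 2 * q powi m"
        using c2 q by (intro mult_strict_right_mono) auto
      ultimately show False using * by simp
    qed
  qed
  have "theta q (- (c ^ 2)) \<noteq> 0"
  proof (rule theta_nonzero[OF q])
    show "qpoch_inf (c ^ 2 * q powi k) q \<noteq> 0" for k
    proof (rule qpoch_inf_nonzero[OF q])
      show "c ^ 2 * q powi k * q ^ j \<noteq> 1" for j
        using nodes[of "k + int j"] q by (simp add: power_int_add mult.assoc)
    qed
  qed (use c0 in simp)
  with zero show False by simp
qed

lemma has_dq_integral_unique:
  "has_dq_integral q f I \<Longrightarrow> has_dq_integral q f J \<Longrightarrow> I = J"
  unfolding has_dq_integral_def by (rule has_sum_unique)

lemma monic_orthogonal_moments:
  assumes q: "0 < q" "q < 1" and c: "c > 0" and P: "monic_orthogonal q c P \<gamma>"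
  shows "orthogonal_family (dq_moment q c) P"
    and "\<gamma> n = moment_functional (dq_moment q c) (P n * P n)"
proof -
  have *: "moment_functional (dq_moment q c) (P n * P m) = (if n = m then \<gamma> n else 0)" for n m
  proof (rule has_dq_integral_unique)
    show "has_dq_integral q (\<lambda>x. poly (P n) (c * x) * poly (P m) (c * x) * weight q (c * x))
      (if n = m then \<gamma> n else 0)"
      using P unfolding monic_orthogonal_def by blast
    show "has_dq_integral q (\<lambda>x. poly (P n) (c * x) * poly (P m) (c * x) * weight q (c * x))
      (moment_functional (dq_moment q c) (P n * P m))"
      using moment_functional_has_integral[OF q c, of "P n * P m"] by simp
  qed
  then show "\<gamma> n = moment_functional (dq_moment q c) (P n * P n)" by simp
  show "orthogonal_family (dq_moment q c) P"
    unfolding orthogonal_family_def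
  proof (intro conjI allI impI)
    show "degree (P n) = n" "lead_coeff (P n) = 1" for n
      using P unfolding monic_orthogonal_def by blast+
  qed (simp add: *)
qed

text \<open>Both values come from orthogonality to the constants. Through the second one the family determines the
  ratio of its moments.\<close>

lemma orthogonal_family_low_degree:
  assumes P: "orthogonal_family M P" and M: "M 0 \<noteq> 0" "M 1 = 0"
  shows "P 1 = [:0, 1:]" and "coeff (P 2) 0 = - (M 2 / M 0)"
proof -
  have deg: "degree (P n) = n" "coeff (P n) n = 1" for n
    using P unfolding orthogonal_family_def by metis+
  have orth: "moment_functional M (P n) = 0" if "n > 0" for n
    using orthogonal_family_lower[OF P, of 1 n "1 :: real poly"] that by (simp add: coeff_eq_0)
  have "coeff (P 1) 0 = 0"
    using orth[of 1] deg[of 1] M by (simp add: moment_functional_def)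
  then show "P 1 = [:0, 1:]"
    using deg[of 1] coeff_eq_0[of "P 1"]
    by (auto simp: poly_eq_iff coeff_pCons split: nat.splits)
  have "coeff (P 2) 0 * M 0 + M 2 = 0"
    using orth[of 2] deg[of 2] M by (simp add: moment_functional_def numeral_2_eq_2)
  then show "coeff (P 2) 0 = - (M 2 / M 0)"
    using M by (simp add: field_simps)
qed

section \<open>The first moment as a rational bilateral sum\<close>

text \<open>The weight with its infinite product cut off after \<open>N\<close> factors. For \<open>N = 1\<close> it is the rational function
  whose bilateral sums make up \<open>h\<^sub>q\<close>; for \<open>N \<rightarrow> \<infinity>\<close> it decreases to the weight.\<close>

definition trunc_weight :: "real \<Rightarrow> nat \<Rightarrow> real \<Rightarrow> real" where
  "trunc_weight q N x = 1 / (\<Prod>j<N. 1 + x ^ 4 * (q ^ 4) ^ j)"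

lemma trunc_weight_pos:
  assumes "q > 0"
  shows "trunc_weight q N x > 0"
  unfolding trunc_weight_def
  using assms by (intro divide_pos_pos prod_pos ballI add_pos_nonneg) auto

lemma trunc_weight_Suc:
  assumes "q > 0"
  shows "(1 + x ^ 4 * (q ^ 4) ^ N) * trunc_weight q (Suc N) x = trunc_weight q N x"
proof -
  have "1 + x ^ 4 * (q ^ 4) ^ N > 0"
    using assms by (intro add_pos_nonneg) auto
  then show ?thesis
    by (simp add: trunc_weight_def)
qed

lemma trunc_weight_Suc_shift:
  assumes "q > 0"
  shows "(1 + x ^ 4) * trunc_weight q (Suc N) x = trunc_weight q N (q * x)"
proof -
  have "1 + x ^ 4 > 0"
    by (intro add_pos_nonneg) auto
  moreover have "(\<Prod>j<Suc N. 1 + x ^ 4 * (q ^ 4) ^ j)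
      = (1 + x ^ 4) * (\<Prod>j<N. 1 + (q * x) ^ 4 * (q ^ 4) ^ j)"
    by (subst prod.lessThan_Suc_shift) (simp add: power_mult_distrib mult_ac)
  ultimately show ?thesis
    unfolding trunc_weight_def by simp
qed

lemma trunc_weight_decreasing:
  assumes "q > 0"
  shows "trunc_weight q (Suc N) x \<le> trunc_weight q N x"
  using trunc_weight_Suc[OF assms, of x N, symmetric] trunc_weight_pos[OF assms, of "Suc N" x] assms
  by (simp add: ring_distribs)

lemma trunc_weight_LIMSEQ:
  assumes q: "0 < q" "q < 1"
  shows "(\<lambda>N. trunc_weight q N x) \<longlonglongrightarrow> weight q x"
proof -
  note Q = power4_bounds[OF q]
  have "qpoch_inf (- (x ^ 4)) (q ^ 4) \<noteq> 0"
    using qpoch_inf_pos[OF Q, of "- (x ^ 4)"] by simp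
  then have "(\<lambda>N. 1 / (\<Prod>j<N. 1 - - (x ^ 4) * (q ^ 4) ^ j)) \<longlonglongrightarrow> 1 / qpoch_inf (- (x ^ 4)) (q ^ 4)"
    by (intro tendsto_divide tendsto_const qpoch_inf_LIMSEQ[OF Q])
  then show ?thesis
    by (simp add: trunc_weight_def weight_def)
qed

definition quartic_sum :: "real \<Rightarrow> real \<Rightarrow> real" where
  "quartic_sum q c = (\<Sum>\<^sub>\<infinity>k. c * q powi k / (1 + (c * q powi k) ^ 4))"

text \<open>The terms are at most \<open>x\<close> and at most \<open>x\<^bsup>-3\<^esup>\<close>, which makes either end a convergent geometric series.\<close>

lemma quartic_sum_has_sum:
  assumes q: "0 < q" "q < 1" and c: "c > 0"
  shows "((\<lambda>k. c * q powi k / (1 + (c * q powi k) ^ 4)) has_sum quartic_sum q c) UNIV"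
proof -
  define f where "f k = c * q powi k / (1 + (c * q powi k) ^ 4)" for k
  have xpos: "c * q powi k > 0" for k using q c by simp
  have dpos: "1 + x ^ 4 > 0" for x :: real by (intro add_pos_nonneg) auto
  have "summable (\<lambda>n. norm (f (int n)))"
  proof (rule summable_comparison_test'[of "\<lambda>n. c * q ^ n" 0])
    show "summable (\<lambda>n. c * q ^ n)"
      using q by (intro summable_mult summable_geometric) auto
    fix n :: nat
    define x where "x = c * q ^ n"
    have x: "x > 0" unfolding x_def using q c by simp
    have f: "f (int n) = x / (1 + x ^ 4)"
      by (simp add: f_def x_def)
    have "x / (1 + x ^ 4) \<le> x / 1"
      using x dpos[of x] by (intro divide_left_mono) auto
    then show "norm (norm (f (int n))) \<le> c * q ^ n"
      using x dpos[of x] unfolding f x_def[symmetric] by simp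
  qed
  moreover have "summable (\<lambda>n. norm (f (- int n)))"
  proof (rule summable_comparison_test'[of "\<lambda>n. 1 / c ^ 3 * (q ^ 3) ^ n" 0])
    show "summable (\<lambda>n. 1 / c ^ 3 * (q ^ 3) ^ n)"
      using q by (intro summable_mult summable_geometric) (simp add: power_abs power_less_one_iff)
    fix n :: nat
    define x where "x = c * q powi - int n"
    have x: "x > 0" unfolding x_def by (rule xpos)
    have "f (- int n) \<le> x / x ^ 4"
      unfolding f_def x_def[symmetric] using x dpos[of x] by (intro divide_left_mono) auto
    also have "\<dots> = 1 / x ^ 3"
      using x by (simp add: eval_nat_numeral)
    also have "\<dots> = 1 / c ^ 3 * (q ^ 3) ^ n"
    proof -
      have "x = c / q ^ n"
        by (simp add: x_def power_int_minus divide_inverse)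
      moreover have "(q ^ n) ^ 3 = (q ^ 3) ^ n"
        by (simp add: power_mult[symmetric] mult.commute)
      ultimately show ?thesis
        by (simp add: power_divide)
    qed
    finally show "norm (norm (f (- int n))) \<le> 1 / c ^ 3 * (q ^ 3) ^ n"
      using x dpos[of x] by (simp add: f_def flip: x_def)
  qed
  ultimately have "(\<lambda>k. norm (f k)) summable_on UNIV"
    by (rule summable_on_int_halves)
  then show ?thesis
    unfolding quartic_sum_def f_def[symmetric] by (rule has_sum_infsum[OF abs_summable_summable])
qed

lemma quartic_sum_pos:
  assumes q: "0 < q" "q < 1" and c: "c > 0"
  shows "quartic_sum q c > 0"
proof (rule has_sum_pos[OF quartic_sum_has_sum[OF assms]])
  show "c * q powi k / (1 + (c * q powi k) ^ 4) > 0" for k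
    using q c by (intro divide_pos_pos add_pos_nonneg) auto
qed

text \<open>Let \<open>E\<^sub>N\<close> be the truncated weight and \<open>R = q\<^bsup>4N\<^esup>\<close>. Splitting off the last or the first factor gives
  \<open>E\<^sub>N(x) = (1 + R x\<^sup>4) E\<^bsub>N+1\<^esub>(x)\<close> and \<open>E\<^sub>N(qx) = (1 + x\<^sup>4) E\<^bsub>N+1\<^esub>(x)\<close>, and elimination of \<open>x\<^sup>4\<close> gives
  \<open>(1 - R) E\<^bsub>N+1\<^esub>(x) = E\<^sub>N(x) - R E\<^sub>N(qx)\<close>. The set of nodes is invariant under \<open>x \<mapsto> qx\<close>, so the sums
  for \<open>N\<close> and \<open>N + 1\<close> differ by a factor that does not involve \<open>c\<close>.\<close>

lemma trunc_weight_sum: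
  assumes q: "0 < q" "q < 1"
  shows "\<exists>C. \<forall>c>0. ((\<lambda>k. c * q powi k * trunc_weight q (Suc N) (c * q powi k)) has_sum
      C * quartic_sum q c) UNIV"
proof (induction N)
  case 0
  show ?case
    using quartic_sum_has_sum[OF q] by (intro exI[of _ 1]) (simp add: trunc_weight_def)
next
  case (Suc N)
  then obtain C where C: "\<And>c. c > 0 \<Longrightarrow>
      ((\<lambda>k. c * q powi k * trunc_weight q (Suc N) (c * q powi k)) has_sum C * quartic_sum q c) UNIV"
    by blast
  define R where "R = (q ^ 4) ^ Suc N"
  have "R < 1"
    unfolding R_def using power4_bounds[OF q] by (rule power_Suc_less_one)
  show ?case
  proof (intro exI[of _ "(1 - R / q) / (1 - R) * C"] allI impI)
    fix c :: real assume c: "c > 0"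
    define f where "f k = c * q powi k * trunc_weight q (Suc N) (c * q powi k)" for k
    have f: "(f has_sum C * quartic_sum q c) UNIV"
      using C[OF c] unfolding f_def .
    have f1: "((\<lambda>k. f (k + 1)) has_sum C * quartic_sum q c) UNIV"
      using f by (subst has_sum_reindex_bij_witness[of _ "\<lambda>k. k - 1" "\<lambda>k. k + 1" UNIV f]) auto
    have "((\<lambda>k. 1 / (1 - R) * (f k + - (R / q) * f (k + 1))) has_sum
        1 / (1 - R) * (C * quartic_sum q c + - (R / q) * (C * quartic_sum q c))) UNIV"
      by (intro has_sum_cmult_right has_sum_add f f1)
    moreover have "1 / (1 - R) * (f k + - (R / q) * f (k + 1))
        = c * q powi k * trunc_weight q (Suc (Suc N)) (c * q powi k)" for k
    proof -
      define x where "x = c * q powi k"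
      define w where "w = trunc_weight q (Suc (Suc N)) x"
      have "f k = x * ((1 + x ^ 4 * R) * w)"
        unfolding f_def w_def R_def x_def using trunc_weight_Suc[OF q(1), of "c * q powi k" "Suc N"]
        by (simp del: power_Suc)
      moreover have "f (k + 1) = q * x * ((1 + x ^ 4) * w)"
        unfolding f_def w_def x_def using trunc_weight_Suc_shift[OF q(1), of "c * q powi k" "Suc N"] q
        by (simp add: power_int_add mult_ac)
      ultimately have "f k + - (R / q) * f (k + 1) = (1 - R) * (x * w)"
        using q by (simp add: algebra_simps)
      then show ?thesis
        using \<open>R < 1\<close> by (simp add: x_def w_def)
    qed
    moreover have "1 / (1 - R) * (C * quartic_sum q c + - (R / q) * (C * quartic_sum q c))
        = (1 - R / q) / (1 - R) * C * quartic_sum q c"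
    proof -
      have "a + - (R / q) * a = (1 - R / q) * a" for a :: real
        by (simp add: left_diff_distrib)
      then show ?thesis by simp
    qed
    ultimately show "((\<lambda>k. c * q powi k * trunc_weight q (Suc (Suc N)) (c * q powi k)) has_sum
        (1 - R / q) / (1 - R) * C * quartic_sum q c) UNIV"
      by (simp only:)
  qed
qed

text \<open>Dominated convergence as \<open>N \<rightarrow> \<infinity>\<close>, with the sum for \<open>N = 1\<close> as majorant. The constants for the
  single \<open>N\<close> converge because the sums for \<open>c = 1\<close> do.\<close>

lemma jackson_first_moment_proportional:
  assumes q: "0 < q" "q < 1"
  shows "\<exists>C. \<forall>c>0. jackson_moment q c 1 = C * quartic_sum q c"
proof -
  have "\<forall>N. \<exists>C. \<forall>c>0. ((\<lambda>k. c * q powi k * trunc_weight q (Suc N) (c * q powi k)) has_sum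
      C * quartic_sum q c) UNIV"
    by (intro allI trunc_weight_sum[OF q])
  from choice[OF this] obtain C where C: "\<forall>N. \<forall>c>0.
      ((\<lambda>k. c * q powi k * trunc_weight q (Suc N) (c * q powi k)) has_sum C N * quartic_sum q c) UNIV"
    ..
  have lim: "(\<lambda>N. C N * quartic_sum q c) \<longlonglongrightarrow> jackson_moment q c 1" if c: "c > 0" for c
  proof -
    define f where "f N k = c * q powi k * trunc_weight q (Suc N) (c * q powi k)" for N k
    define g where "g k = c * q powi k * weight q (c * q powi k)" for k
    have sums: "(\<lambda>n. h (int_decode n)) sums S" if "(h has_sum S) UNIV" for h :: "int \<Rightarrow> real" and S
      by (rule has_sum_imp_sums) (simp add: has_sum_reindex_bij_betw[OF bij_int_decode] that)
    have fs: "(\<lambda>n. f N (int_decode n)) sums (C N * quartic_sum q c)" for N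
      unfolding f_def by (rule sums) (use C c in blast)
    have gs: "(\<lambda>n. g (int_decode n)) sums jackson_moment q c 1"
      unfolding g_def by (rule sums) (use jackson_moment_has_sum[OF q c, of 1] in simp)
    have f_nonneg: "f N k \<ge> 0" for N k
      using trunc_weight_pos[OF q(1)] q c by (simp add: f_def less_imp_le)
    have f_le: "f N k \<le> f 0 k" for N k
    proof (induction N)
      case (Suc N)
      have "f (Suc N) k \<le> f N k"
        unfolding f_def using q c trunc_weight_decreasing[OF q(1)] by (intro mult_left_mono) auto
      with Suc show ?case by simp
    qed simp
    have "(\<lambda>N. \<Sum>n. f N (int_decode n)) \<longlonglongrightarrow> (\<Sum>n. g (int_decode n))"
    proof (rule tannerys_theorem[THEN conjunct2, THEN conjunct2])
      show "(\<lambda>N. f N (int_decode n)) \<longlonglongrightarrow> g (int_decode n)" for n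
        unfolding f_def g_def
        by (intro tendsto_mult tendsto_const LIMSEQ_Suc[OF trunc_weight_LIMSEQ[OF q]])
      show "\<forall>\<^sub>F (n, N) in sequentially \<times>\<^sub>F sequentially. norm (f N (int_decode n)) \<le> f 0 (int_decode n)"
        using f_nonneg f_le by (intro always_eventually) auto
      show "summable (\<lambda>n. f 0 (int_decode n))"
        by (rule sums_summable[OF fs])
    qed simp
    then show ?thesis
      using fs gs by (simp add: sums_iff)
  qed
  have pos: "quartic_sum q 1 > 0" by (rule quartic_sum_pos[OF q]) simp
  show ?thesis
  proof (intro exI[of _ "jackson_moment q 1 1 / quartic_sum q 1"] allI impI)
    fix c :: real assume c: "c > 0"
    have "(\<lambda>N. C N * quartic_sum q 1 / quartic_sum q 1 * quartic_sum q c) \<longlonglongrightarrow>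
        jackson_moment q 1 1 / quartic_sum q 1 * quartic_sum q c"
      using lim[of 1] pos by (intro tendsto_mult tendsto_divide tendsto_const) auto
    then have "(\<lambda>N. C N * quartic_sum q c) \<longlonglongrightarrow>
        jackson_moment q 1 1 / quartic_sum q 1 * quartic_sum q c"
      using pos by simp
    with lim[OF c] show "jackson_moment q c 1 = jackson_moment q 1 1 / quartic_sum q 1 * quartic_sum q c"
      by (rule LIMSEQ_unique)
  qed
qed

section \<open>Values of the function h on the diagonal\<close>

text \<open>Under the hypothesis on \<open>c\<close> the set of nodes \<open>c q\<^sup>k\<close> is closed under inversion, and \<open>x \<mapsto> 1/x\<close>
  exchanges \<open>x / (1 + x\<^sup>4)\<close> and \<open>x\<^sup>3 / (1 + x\<^sup>4)\<close>.\<close>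

lemma quartic_sum_inverted:
  assumes q: "0 < q" "q < 1" and c: "c > 0" and sym: "c ^ 2 = q powi m"
  shows "((\<lambda>k. (c * q powi k) ^ 3 / (1 + (c * q powi k) ^ 4)) has_sum quartic_sum q c) UNIV"
proof -
  have "(c * q powi k) ^ 3 / (1 + (c * q powi k) ^ 4)
      = c * q powi (- m - k) / (1 + (c * q powi (- m - k)) ^ 4)" for k
  proof -
    define x where "x = c * q powi k"
    have x: "x > 0" using q c by (simp add: x_def)
    have "c * q powi (- m - k) * x = c ^ 2 * q powi (- m)"
      using q by (simp add: x_def power2_eq_square power_int_diff)
    also have "\<dots> = 1" using q by (simp add: sym power_int_minus)
    finally have "c * q powi (- m - k) = 1 / x" using x by (simp add: field_simps)
    moreover have "x ^ 3 / (1 + x ^ 4) = 1 / x / (1 + (1 / x) ^ 4)"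
    proof -
      have "1 + (1 / x) ^ 4 = (1 + x ^ 4) / x ^ 4"
        using x by (simp add: power_divide field_simps)
      moreover have "x ^ 4 = x * x ^ 3"
        by (simp add: eval_nat_numeral)
      ultimately show ?thesis
        using x by simp
    qed
    ultimately show ?thesis
      by (simp only: flip: x_def)
  qed
  then show ?thesis
    using quartic_sum_has_sum[OF q c]
    by (subst has_sum_reindex_bij_witness[of _ "\<lambda>k. - m - k" "\<lambda>k. - m - k" UNIV
        "\<lambda>k. c * q powi k / (1 + (c * q powi k) ^ 4)"]) auto
qed

text \<open>With \<open>z\<^sup>2 = \<i>\<close> and \<open>x = c q\<^bsup>-k\<^esup>\<close>, rationalising the \<open>k\<close>-th term gives \<open>- 2 z\<close> times
  \<open>x / (1 + x\<^sup>4) + \<i> x\<^sup>3 / (1 + x\<^sup>4)\<close>. Both parts have the same sum when the nodes are closed under inversion,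
  as they are for \<open>c = 1\<close> and \<open>c = q\<^bsup>1/2\<^esup>\<close>.\<close>

lemma hq_diagonal:
  assumes q: "0 < q" "q < 1" and c: "c > 0" and sym: "c ^ 2 = q powi m"
  shows "hq q (of_real c * cis (pi / 4)) = - 2 * cis (pi / 4) * (1 + \<i>) * of_real (quartic_sum q c)"
proof -
  define z where "z = cis (pi / 4)"
  define x where "x k = c * q powi k" for k
  have z2: "z ^ 2 = \<i>"
    by (simp add: z_def power2_eq_square cis_mult)
  define h where "h x = complex_of_real (x / (1 + x ^ 4)) + \<i> * complex_of_real (x ^ 3 / (1 + x ^ 4))" for x
  have "((\<lambda>k. - 2 * z * h (x k)) has_sum
      - 2 * z * (of_real (quartic_sum q c) + \<i> * of_real (quartic_sum q c))) UNIV"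
    unfolding h_def x_def
    by (intro has_sum_cmult_right has_sum_add has_sum_of_real quartic_sum_has_sum[OF q c]
        quartic_sum_inverted[OF q c sym])
  then have "((\<lambda>k. - 2 * z * h (x (- k))) has_sum
      - 2 * z * (of_real (quartic_sum q c) + \<i> * of_real (quartic_sum q c))) UNIV"
    by (subst has_sum_reindex_bij_witness[of _ uminus uminus UNIV "\<lambda>k. - 2 * z * h (x k)"]) auto
  moreover have "- 2 * z * h (x (- k))
      = 2 * (of_real c * z) * of_real (q powi k) / ((of_real c * z)\<^sup>2 - of_real (q powi (2 * k)))" for k
  proof -
    define r where "r = q powi k"
    have r: "r > 0" using q by (simp add: r_def)
    have r2: "q powi (2 * k) = r ^ 2"
      by (simp add: r_def power_int_power' mult.commute)
    have xr: "x (- k) = c / r"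
      by (simp add: x_def r_def power_int_minus divide_inverse)
    have d: "c ^ 4 + r ^ 4 > 0" using c r by (simp add: add_pos_pos)
    have "x (- k) / (1 + x (- k) ^ 4) = c * r ^ 3 / (c ^ 4 + r ^ 4)"
      "x (- k) ^ 3 / (1 + x (- k) ^ 4) = c ^ 3 * r / (c ^ 4 + r ^ 4)"
      unfolding xr using c r d by (simp_all add: field_simps eval_nat_numeral)
    then have hx: "h (x (- k)) = (of_real c * of_real r ^ 3 + \<i> * (of_real c ^ 3 * of_real r))
        / of_real (c ^ 4 + r ^ 4)"
      unfolding h_def by (simp add: add_divide_distrib)
    define a where "a = complex_of_real c"
    define b where "b = complex_of_real r"
    have prod: "(\<i> * a ^ 2 - b ^ 2) * (- \<i> * a ^ 2 - b ^ 2) = of_real (c ^ 4 + r ^ 4)"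
      by (simp add: a_def b_def algebra_simps eval_nat_numeral)
    have nz: "of_real (c ^ 4 + r ^ 4) \<noteq> (0 :: complex)"
      using d by (simp only: of_real_eq_0_iff)
    then have nz': "\<i> * a ^ 2 - b ^ 2 \<noteq> 0"
      unfolding prod[symmetric] by auto
    have "- 2 * z * h (x (- k)) = 2 * (a * z) * b * (- \<i> * a ^ 2 - b ^ 2) / of_real (c ^ 4 + r ^ 4)"
      unfolding hx by (simp add: a_def b_def algebra_simps eval_nat_numeral)
    also have "\<dots> = 2 * (a * z) * b / (\<i> * a ^ 2 - b ^ 2)"
    proof -
      have "- \<i> * a ^ 2 - b ^ 2 \<noteq> 0"
        using nz unfolding prod[symmetric] by auto
      then show ?thesis
        unfolding prod[symmetric] by (rule nonzero_mult_divide_mult_cancel_right)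
    qed
    also have "\<dots> = 2 * (a * z) * b / ((a * z) ^ 2 - of_real (q powi (2 * k)))"
    proof -
      have "(a * z) ^ 2 - of_real (q powi (2 * k)) = \<i> * a ^ 2 - b ^ 2"
        unfolding r2 by (simp add: power_mult_distrib z2 b_def)
      then show ?thesis by (simp only:)
    qed
    finally show ?thesis by (simp add: a_def b_def r_def)
  qed
  ultimately have "((\<lambda>k. 2 * (of_real c * z) * of_real (q powi k)
      / ((of_real c * z)\<^sup>2 - of_real (q powi (2 * k)))) has_sum
      - 2 * z * (of_real (quartic_sum q c) + \<i> * of_real (quartic_sum q c))) UNIV"
    by simp
  then have "hq q (of_real c * z) = - 2 * z * (of_real (quartic_sum q c) + \<i> * of_real (quartic_sum q c))"
    unfolding hq_def by (rule infsumI)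
  then show ?thesis
    by (simp add: z_def algebra_simps)
qed

section \<open>Comparison of the orthogonal polynomials\<close>

theorem lemma8p1:
  fixes q :: real
    and P :: "real \<Rightarrow> nat \<Rightarrow> real poly"
    and \<gamma> :: "real \<Rightarrow> nat \<Rightarrow> real"
  assumes "0 < q" and "q < 1"
    and "\<And>c. q < c \<Longrightarrow> c \<le> 1 \<Longrightarrow> monic_orthogonal q c (P c) (\<gamma> c)"
  shows "P 1 = P (sqrt q)
    \<and> complex_of_real (\<gamma> 1 1 / \<gamma> (sqrt q) 1)
        = complex_of_real (sqrt q) * hq q (cis (pi / 4))
            / hq q (complex_of_real (sqrt q) * cis (pi / 4))
    \<and> (\<forall>c. q < c \<and> c \<le> 1 \<and> c \<noteq> 1 \<and> c \<noteq> sqrt q \<longrightarrow> P c \<noteq> P 1)"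
proof -
  note q = assms(1,2)
  define s where "s = sqrt q"
  have s: "q < s" "s < 1" "0 < s" "s ^ 2 = q"
    using q real_sqrt_less_mono[of "q ^ 2" q] by (auto simp: s_def power2_eq_square)
  have fam: "orthogonal_family (dq_moment q c) (P c)"
    and norms: "\<gamma> c n = moment_functional (dq_moment q c) (P c n * P c n)"
    if "q < c" "c \<le> 1" for c n
    using monic_orthogonal_moments[OF q _ assms(3)[OF that]] that q by auto
  have m0: "dq_moment q c 0 > 0" and m1: "dq_moment q c 1 = 0" and m2: "dq_moment q c 2 > 0"
    if "c > 0" for c
    using that jackson_moment_pos[OF q that] by (auto simp: dq_moment_def)
  have low: "P c 1 = [:0, 1:]" "coeff (P c 2) 0 = - (dq_moment q c 2 / dq_moment q c 0)"
    if c: "q < c" "c \<le> 1" for c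
    using orthogonal_family_low_degree[OF fam[OF c]] m0[of c] m1[of c] c q by auto

  \<comment> \<open>The moments for \<open>s\<close> are \<open>\<tau>\<close> times those for \<open>1\<close>, so the two functionals have the same orthogonal polynomials.\<close>
  define \<tau> where "\<tau> = theta_prod (q ^ 4) (- 1) / theta_prod (q ^ 4) (- (q ^ 2))"
  have \<tau>: "\<tau> > 0"
    using theta_prod_neg_pos[OF power4_bounds[OF q]] q by (auto simp: \<tau>_def)
  have scale: "dq_moment q s = (\<lambda>i. \<tau> * dq_moment q 1 i)"
    using dq_moment_sqrt[OF q] by (auto simp: \<tau>_def s_def)
  have same: "P 1 = P s"
  proof (rule orthogonal_family_unique)
    show "orthogonal_family (dq_moment q 1) (P 1)"
      using fam[of 1] q by simp
    show "orthogonal_family (dq_moment q 1) (P s)"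
      using fam[of s] s \<tau> unfolding scale orthogonal_family_def moment_functional_scale
      by (metis less_irrefl less_imp_le mult_eq_0_iff)
    show "d = 0" if "moment_functional (dq_moment q 1) (d * d) = 0" for d
      by (rule moment_functional_definite[OF q zero_less_one that])
  qed

  have \<gamma>1: "\<gamma> c 1 = dq_moment q c 2" if c: "q < c" "c \<le> 1" for c
  proof -
    have "\<gamma> c 1 = moment_functional (dq_moment q c) [:0, 0, 1:]"
      using norms[OF c, of 1] low(1)[OF c] by simp
    then show ?thesis
      by (simp add: moment_functional_def numeral_2_eq_2)
  qed
  obtain C where C: "\<And>c. c > 0 \<Longrightarrow> jackson_moment q c 1 = C * quartic_sum q c"
    using jackson_first_moment_proportional[OF q] by blast
  have Apos: "quartic_sum q 1 > 0" "quartic_sum q s > 0"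
    using quartic_sum_pos[OF q] s by auto
  have "C \<noteq> 0"
    using C[of 1] jackson_moment_pos[OF q, of 1 1] by auto
  have "\<gamma> 1 1 / \<gamma> s 1 = 1 / \<tau>"
    using \<gamma>1[of 1] \<gamma>1[of s] s q scale m2[of 1] by simp
  \<comment> \<open>The factor \<open>\<tau>\<close> is the same in degree \<open>0\<close>, where the moments are sums proportional to those in \<open>h\<^sub>q\<close>.\<close>
  also have "\<dots> = dq_moment q 1 0 / dq_moment q s 0"
    using m0[of 1] scale by simp
  also have "\<dots> = s * quartic_sum q 1 / quartic_sum q s"
    using C[of 1] C[of s] s \<open>C \<noteq> 0\<close> by (simp add: dq_moment_def)
  finally have ratio: "\<gamma> 1 1 / \<gamma> s 1 = s * quartic_sum q 1 / quartic_sum q s" .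
  define \<kappa> where "\<kappa> = - 2 * cis (pi / 4) * (1 + \<i>)"
  have "\<kappa> \<noteq> 0"
  proof -
    have "1 + \<i> \<noteq> 0" by (simp add: complex_eq_iff)
    then show ?thesis by (simp add: \<kappa>_def)
  qed
  have "hq q (cis (pi / 4)) = \<kappa> * of_real (quartic_sum q 1)"
    using hq_diagonal[OF q, of 1 0] by (simp add: \<kappa>_def)
  moreover have "hq q (of_real s * cis (pi / 4)) = \<kappa> * of_real (quartic_sum q s)"
    using hq_diagonal[OF q, of s 1] s by (simp add: \<kappa>_def)
  ultimately have "complex_of_real (\<gamma> 1 1 / \<gamma> s 1)
      = of_real s * hq q (cis (pi / 4)) / hq q (of_real s * cis (pi / 4))"
    unfolding ratio using \<open>\<kappa> \<noteq> 0\<close> by simp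
  moreover have "P c \<noteq> P 1" if "q < c \<and> c \<le> 1 \<and> c \<noteq> 1 \<and> c \<noteq> s" for c
  proof
    assume "P c = P 1"
    then have "dq_moment q c 2 / dq_moment q c 0 = dq_moment q 1 2 / dq_moment q 1 0"
      using low(2)[of c] low(2)[of 1] that q by simp
    then show False
      using moment_ratio_distinct[OF q, of c] that by (simp add: s_def)
  qed
  ultimately show ?thesis
    using same by (simp add: s_def)
qed

end
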